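(* Let $n\ge 3$ and consider the affine Weyl group $W_{\mathrm{aff}}$ of type $A_{n-1}^{(1)}$. Let $\mathbf d=(d_0,\dots,d_{n-1})$ be a degree such that $d_i=0$ for some $i$. Then there are positive real roots $\gamma_1,\dots,\gamma_r$ (with $r\ge0$) such that $z_{\mathbf d}=s_{\gamma_1}s_{\gamma_2}\cdots s_{\gamma_r}$ and such that, for all $1\le i,j\le r$ with $i\ne j$, either $\operatorname{supp}(\gamma_i)$ and $\operatorname{supp}(\gamma_j)$ are disconnected, or both $\gamma_i\perp\gamma_j$ and $\gamma_i,\gamma_j$ are comparable. Moreover, the product $s_{\gamma_1}s_{\gamma_2}\cdots s_{\gamma_r}$ is reduced (i.e. $\ell(z_{\mathbf d})=\sum_{i=1}^r\ell(s_{\gamma_i})$), and $\ell(z_{\mathbf d})=\sum_{i=1}^r\bigl(2|\operatorname{supp}(\gamma_i)|-1\bigr)$.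
   Context: Roots. Let $n\ge 3$. Let $\alpha_0,\dots,\alpha_{n-1}$ (indices mod $n$) be the affine simple roots of type $A_{n-1}^{(1)}$, $Q_{\mathrm{aff}}=\bigoplus_{i=0}^{n-1}\mathbb Z\alpha_i$, with symmetric form $\langle\alpha_i,\alpha_i\rangle=2$, $\langle\alpha_i,\alpha_{i\pm1}\rangle=-1$, all other $\langle\alpha_i,\alpha_j\rangle=0$; $\perp$ refers to this form. For $a,b\in Q_{\mathrm{aff}}$, $a\le b$ means $b-a$ has non-negative coefficients; comparable means $a\le b$ or $b\le a$. Put $c=\sum_{i=0}^{n-1}\alpha_i$. Let $\Pi=\Pi^+\sqcup\Pi^-$ be the finite root system of type $A_{n-1}$ with simple roots $\alpha_1,\dots,\alpha_{n-1}$. The affine real roots are $\alpha+mc$ with $\alpha\in\Pi$, $m\in\mathbb Z$; such a root is positive if $m>0$, or $m=0$ and $\alpha\in\Pi^+$. For $\alpha=\sum a_i\alpha_i$, $\operatorname{supp}(\alpha)=\{\alpha_i:a_i\ne0\}$. Two supports are disconnected if they are disjoint and no simple root in one is adjacent (in the cyclic Dynkin diagram) to a simple root in the other. Weyl group. For a real root $\alpha$, $s_\alpha(\mu)=\mu-\langle\mu,\alpha\rangle\alpha$. $W_{\mathrm{aff}}$ is the group generated by $s_i=s_{\alpha_i}$, $0\le i\le n-1$ (a Coxeter group with these generators), with length $\ell$. Hecke product: $u\cdot s_i=us_i$ if $\ell(us_i)>\ell(u)$ and $u\cdot s_i=u$ otherwise; $u\cdot v=u\cdot s_{i_1}\cdots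 s_{i_k}$ (applied left to right) for any reduced expression $v=s_{i_1}\cdots s_{i_k}$. This is a well-defined associative product. Degrees and $z_{\mathbf d}$. A degree is a tuple $\mathbf d=(d_0,\dots,d_{n-1})\in\mathbb Z_{\ge0}^n$, identified with $\sum d_i\alpha_i$. For a degree $\mathbf d$ with $d_i=0$ for some $i$: $z_{\mathbf 0}=id$, and for $\mathbf d\ne0$, $z_{\mathbf d}=s_\alpha\cdot z_{\mathbf d-\alpha}$ (Hecke product) where $\alpha$ is any maximal element of the set of positive real roots $\le\mathbf d$; this is independent of choices. *)

theory Defs
  imports "HOL-Library.Function_Algebras"
begin

text \<open>
  The type is $A_{n-1}^{(1)}$.  The element $\sum_{i<n} a_i \alpha_i$ of the root lattice is its coefficient function
  \<open>a :: nat \<Rightarrow> int\<close>, which vanishes from \<open>n\<close> on.  Addition, subtraction, \<open>0\<close> and \<open>\<le>\<close> on such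
  functions are the pointwise ones, so \<open>a \<le> b\<close> says that \<open>b - a\<close> has non-negative coefficients.
\<close>

definition root_lattice :: "nat \<Rightarrow> (nat \<Rightarrow> int) set" where
  "root_lattice n = {a. \<forall>i\<ge>n. a i = 0}"

definition simple_root :: "nat \<Rightarrow> nat \<Rightarrow> int" where
  "simple_root i = (\<lambda>k. if k = i then 1 else 0)"

definition adjacent :: "nat \<Rightarrow> nat \<Rightarrow> nat \<Rightarrow> bool" where
  "adjacent n i j \<longleftrightarrow> j = (i + 1) mod n \<or> i = (j + 1) mod n"

definition cartan :: "nat \<Rightarrow> nat \<Rightarrow> nat \<Rightarrow> int" where
  "cartan n i j = (if i = j then 2 else if adjacent n i j then -1 else 0)"

definition root_form :: "nat \<Rightarrow> (nat \<Rightarrow> int) \<Rightarrow> (nat \<Rightarrow> int) \<Rightarrow> int" where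
  "root_form n a b = (\<Sum>i<n. \<Sum>j<n. a i * b j * cartan n i j)"

definition null_root :: "nat \<Rightarrow> nat \<Rightarrow> int" where
  "null_root n = (\<Sum>i<n. simple_root i)"

definition finite_pos_roots :: "nat \<Rightarrow> (nat \<Rightarrow> int) set" where
  "finite_pos_roots n = {(\<Sum>k\<in>{i..j}. simple_root k) | i j. 1 \<le> i \<and> i \<le> j \<and> j < n}"

definition finite_roots :: "nat \<Rightarrow> (nat \<Rightarrow> int) set" where
  "finite_roots n = finite_pos_roots n \<union> uminus ` finite_pos_roots n"

definition pos_real_roots :: "nat \<Rightarrow> (nat \<Rightarrow> int) set" where
  "pos_real_roots n =
     {\<alpha> + (\<lambda>k. m * null_root n k) | \<alpha> m.
        \<alpha> \<in> finite_roots n \<and> (m > 0 \<or> m = 0 \<and> \<alpha> \<in> finite_pos_roots n)}"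

text \<open>The simple root \<open>\<alpha>\<^sub>i\<close> is represented in a support by its index \<open>i\<close>.\<close>

definition supp :: "nat \<Rightarrow> (nat \<Rightarrow> int) \<Rightarrow> nat set" where
  "supp n a = {i. i < n \<and> a i \<noteq> 0}"

definition disconnected :: "nat \<Rightarrow> nat set \<Rightarrow> nat set \<Rightarrow> bool" where
  "disconnected n A B \<longleftrightarrow> A \<inter> B = {} \<and> (\<forall>i\<in>A. \<forall>j\<in>B. \<not> adjacent n i j)"

text \<open>
  Elements of the group are maps on coefficient functions, multiplied by composition.  The
  reflections are applied to all functions \<open>nat \<Rightarrow> int\<close>; they do not touch the coefficients from
  \<open>n\<close> on, and the form does not see these, so two products of reflections are equal as maps
  exactly when they agree on \<^const>\<open>root_lattice\<close>.
\<close>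

definition reflection :: "nat \<Rightarrow> (nat \<Rightarrow> int) \<Rightarrow> (nat \<Rightarrow> int) \<Rightarrow> (nat \<Rightarrow> int)" where
  "reflection n \<alpha> \<mu> = (\<lambda>k. \<mu> k - root_form n \<mu> \<alpha> * \<alpha> k)"

definition reflection_prod :: "nat \<Rightarrow> (nat \<Rightarrow> int) list \<Rightarrow> (nat \<Rightarrow> int) \<Rightarrow> (nat \<Rightarrow> int)" where
  "reflection_prod n \<gamma>s = foldr (\<lambda>\<gamma> w. reflection n \<gamma> \<circ> w) \<gamma>s id"

definition simple_reflection :: "nat \<Rightarrow> nat \<Rightarrow> (nat \<Rightarrow> int) \<Rightarrow> (nat \<Rightarrow> int)" where
  "simple_reflection n i = reflection n (simple_root i)"

definition word_prod :: "nat \<Rightarrow> nat list \<Rightarrow> (nat \<Rightarrow> int) \<Rightarrow> (nat \<Rightarrow> int)" where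
  "word_prod n is = foldr (\<lambda>i w. simple_reflection n i \<circ> w) is id"

text \<open>
  The simple reflections are involutions, so the group they generate consists of the values of
  \<^const>\<open>word_prod\<close> on words over \<open>{..<n}\<close>; the length is meaningful on these values only.
\<close>

definition weyl_length :: "nat \<Rightarrow> ((nat \<Rightarrow> int) \<Rightarrow> (nat \<Rightarrow> int)) \<Rightarrow> nat" where
  "weyl_length n w = (LEAST k. \<exists>is. set is \<subseteq> {..<n} \<and> length is = k \<and> word_prod n is = w)"

definition reduced_expression :: "nat \<Rightarrow> ((nat \<Rightarrow> int) \<Rightarrow> (nat \<Rightarrow> int)) \<Rightarrow> nat list \<Rightarrow> bool" where
  "reduced_expression n w is \<longleftrightarrow>
     set is \<subseteq> {..<n} \<and> word_prod n is = w \<and> length is = weyl_length n w"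

definition hecke_simple ::
  "nat \<Rightarrow> ((nat \<Rightarrow> int) \<Rightarrow> (nat \<Rightarrow> int)) \<Rightarrow> nat \<Rightarrow> ((nat \<Rightarrow> int) \<Rightarrow> (nat \<Rightarrow> int))" where
  "hecke_simple n u i =
     (if weyl_length n (u \<circ> simple_reflection n i) > weyl_length n u
      then u \<circ> simple_reflection n i else u)"

text \<open>The Hecke product does not depend on the reduced expression of the right factor.\<close>

definition hecke_prod ::
  "nat \<Rightarrow> ((nat \<Rightarrow> int) \<Rightarrow> (nat \<Rightarrow> int)) \<Rightarrow> ((nat \<Rightarrow> int) \<Rightarrow> (nat \<Rightarrow> int)) \<Rightarrow> ((nat \<Rightarrow> int) \<Rightarrow> (nat \<Rightarrow> int))" where
  "hecke_prod n u v = foldl (hecke_simple n) u (SOME is. reduced_expression n v is)"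

definition is_degree :: "nat \<Rightarrow> (nat \<Rightarrow> int) \<Rightarrow> bool" where
  "is_degree n d \<longleftrightarrow> d \<in> root_lattice n \<and> 0 \<le> d"

definition maximal_root :: "nat \<Rightarrow> (nat \<Rightarrow> int) \<Rightarrow> (nat \<Rightarrow> int) \<Rightarrow> bool" where
  "maximal_root n d \<alpha> \<longleftrightarrow>
     \<alpha> \<in> pos_real_roots n \<and> \<alpha> \<le> d \<and>
     (\<forall>\<beta>\<in>pos_real_roots n. \<beta> \<le> d \<and> \<alpha> \<le> \<beta> \<longrightarrow> \<beta> = \<alpha>)"

definition height :: "nat \<Rightarrow> (nat \<Rightarrow> int) \<Rightarrow> nat" where
  "height n a = nat (\<Sum>i<n. a i)"

lemma sum_simple_root_apply:
  "finite A \<Longrightarrow> (\<Sum>k\<in>A. simple_root k) l = (if l \<in> A then 1 else 0)"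
  by (induction A rule: finite_induct) (auto simp: simple_root_def)

lemma null_root_apply: "null_root n k = (if k < n then 1 else 0)"
  by (simp add: null_root_def sum_simple_root_apply)

lemma finite_pos_root_cases:
  assumes "\<alpha> \<in> finite_pos_roots n"
  obtains i j where "1 \<le> i" "i \<le> j" "j < n" "\<And>k. \<alpha> k = (if i \<le> k \<and> k \<le> j then 1 else 0)"
  using assms by (auto simp: finite_pos_roots_def sum_simple_root_apply)

lemma pos_real_root_props:
  assumes "\<gamma> \<in> pos_real_roots n"
  shows "\<gamma> \<in> root_lattice n" "0 \<le> \<gamma>" "\<exists>i<n. 0 < \<gamma> i"
proof -
  obtain \<alpha> m where \<gamma>: "\<gamma> = \<alpha> + (\<lambda>k. m * null_root n k)" and \<alpha>: "\<alpha> \<in> finite_roots n"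
    and m: "m > 0 \<or> m = 0 \<and> \<alpha> \<in> finite_pos_roots n"
    using assms by (auto simp: pos_real_roots_def)
  have "\<gamma> \<in> root_lattice n \<and> 0 \<le> \<gamma> \<and> (\<exists>i<n. 0 < \<gamma> i)"
  proof (cases "\<alpha> \<in> finite_pos_roots n")
    case True
    then obtain i j where "1 \<le> i" "i \<le> j" "j < n"
      and "\<And>k. \<alpha> k = (if i \<le> k \<and> k \<le> j then 1 else 0)"
      by (rule finite_pos_root_cases) blast
    then show ?thesis using m
      by (auto simp: \<gamma> root_lattice_def le_fun_def null_root_apply intro!: exI[of _ i])
  next
    case False
    then obtain \<beta> where \<beta>: "\<beta> \<in> finite_pos_roots n" "\<alpha> = - \<beta>"
      using \<alpha> by (auto simp: finite_roots_def)
    obtain i j where "1 \<le> i" "i \<le> j" "j < n"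
      and "\<And>k. \<beta> k = (if i \<le> k \<and> k \<le> j then 1 else 0)"
      using \<beta>(1) by (rule finite_pos_root_cases) blast
    then show ?thesis using m False
      by (auto simp: \<gamma> \<beta>(2) root_lattice_def le_fun_def null_root_apply intro!: exI[of _ 0])
  qed
  then show "\<gamma> \<in> root_lattice n" "0 \<le> \<gamma>" "\<exists>i<n. 0 < \<gamma> i" by auto
qed

lemma simple_root_pos_real:
  assumes "2 \<le> n" "i < n"
  shows "simple_root i \<in> pos_real_roots n"
proof (cases "i = 0")
  case True
  have mem: "(\<Sum>k\<in>{1..n-1}. simple_root k) \<in> finite_pos_roots n"
    using assms unfolding finite_pos_roots_def
    by (intro CollectI exI[of _ 1] exI[of _ "n - 1"]) auto
  have "simple_root i = - (\<Sum>k\<in>{1..n-1}. simple_root k) + (\<lambda>k. 1 * null_root n k)"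
  proof (rule ext)
    fix k
    show "simple_root i k = (- (\<Sum>k\<in>{1..n-1}. simple_root k) + (\<lambda>k. 1 * null_root n k)) k"
      using assms True
      by (auto simp: sum_simple_root_apply null_root_apply simple_root_def[of 0])
  qed
  then show ?thesis using mem unfolding pos_real_roots_def finite_roots_def
    by (intro CollectI exI[of _ "- (\<Sum>k\<in>{1..n-1}. simple_root k)"] exI[of _ 1]) auto
next
  case False
  have "simple_root i = (\<Sum>k\<in>{i..i}. simple_root k)" by simp
  then have "simple_root i \<in> finite_pos_roots n"
    using False assms unfolding finite_pos_roots_def
    by (intro CollectI exI[of _ i]) auto
  moreover have "simple_root i = simple_root i + (\<lambda>k. 0 * null_root n k)"
    by (auto simp: fun_eq_iff)
  ultimately show ?thesis unfolding pos_real_roots_def finite_roots_def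
    by (intro CollectI exI[of _ "simple_root i"] exI[of _ 0]) auto
qed

lemma maximal_root_exists:
  assumes "2 \<le> n" "is_degree n d" "d \<noteq> 0"
  shows "\<exists>\<alpha>. maximal_root n d \<alpha>"
proof -
  let ?P = "\<lambda>\<alpha>. \<alpha> \<in> pos_real_roots n \<and> \<alpha> \<le> d"
  have d0: "0 \<le> d i" for i using assms(2) by (auto simp: is_degree_def le_fun_def)
  obtain i where i: "d i \<noteq> 0" using assms(3) by (auto simp: fun_eq_iff)
  have "i < n" using assms(2) i by (auto simp: is_degree_def root_lattice_def not_less[symmetric])
  moreover have "simple_root i \<le> d"
  proof -
    have "1 \<le> d i" using i d0[of i] by linarith
    then show ?thesis using d0 by (auto simp: le_fun_def simple_root_def)
  qed
  ultimately have P: "?P (simple_root i)" using assms(1) simple_root_pos_real by blast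
  have bound: "\<forall>\<alpha>. ?P \<alpha> \<longrightarrow> height n \<alpha> < Suc (height n d)"
    unfolding height_def le_fun_def less_Suc_eq_le by (blast intro: nat_mono sum_mono)
  have "\<exists>\<alpha>. ?P \<alpha> \<and> (\<forall>\<beta>. ?P \<beta> \<longrightarrow> height n \<beta> \<le> height n \<alpha>)"
    by (rule ex_has_greatest_nat[OF P bound])
  then obtain \<alpha> where \<alpha>: "?P \<alpha>" and max: "\<And>\<beta>. ?P \<beta> \<Longrightarrow> height n \<beta> \<le> height n \<alpha>"
    by blast
  have "\<beta> = \<alpha>" if \<beta>: "\<beta> \<in> pos_real_roots n" "\<beta> \<le> d" "\<alpha> \<le> \<beta>" for \<beta>
  proof (rule ccontr)
    assume "\<beta> \<noteq> \<alpha>"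
    then obtain k where k: "\<beta> k \<noteq> \<alpha> k" by (auto simp: fun_eq_iff)
    then have "k < n"
      using pos_real_root_props(1)[OF \<beta>(1)] pos_real_root_props(1)[of \<alpha> n] \<alpha>
      by (cases "k < n") (auto simp: root_lattice_def)
    moreover have "\<alpha> k < \<beta> k" using \<beta>(3) k by (metis le_fun_def order_le_less)
    ultimately have less: "(\<Sum>i<n. \<alpha> i) < (\<Sum>i<n. \<beta> i)"
      using \<beta>(3) by (intro sum_strict_mono_ex1) (auto simp: le_fun_def)
    have "0 \<le> (\<Sum>i<n. \<alpha> i)"
      using pos_real_root_props(2)[of \<alpha> n] \<alpha> by (intro sum_nonneg) (auto simp: le_fun_def)
    then have "height n \<alpha> < height n \<beta>" using less by (simp add: height_def)
    then show False using max[of \<beta>] \<beta> by auto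
  qed
  then show ?thesis using \<alpha> by (auto simp: maximal_root_def)
qed

lemma height_diff_maximal_root:
  assumes "is_degree n d" "maximal_root n d \<alpha>"
  shows "height n (d - \<alpha>) < height n d"
proof -
  have \<alpha>: "\<alpha> \<in> pos_real_roots n" "\<alpha> \<le> d" using assms(2) by (auto simp: maximal_root_def)
  have "0 < (\<Sum>i<n. \<alpha> i)"
  proof -
    obtain k where "k < n" "0 < \<alpha> k" using pos_real_root_props(3)[OF \<alpha>(1)] by blast
    then show ?thesis
      using pos_real_root_props(2)[OF \<alpha>(1)] by (intro sum_pos2[of _ k]) (auto simp: le_fun_def)
  qed
  moreover have "(\<Sum>i<n. \<alpha> i) \<le> (\<Sum>i<n. d i)" using \<alpha>(2) by (auto simp: le_fun_def intro!: sum_mono)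
  ultimately show ?thesis by (simp add: height_def sum_subtractf)
qed

text \<open>
  The result does not depend on the maximal root that is chosen.  The recursion is only of
  interest for degrees with a vanishing coefficient; the guards on \<open>n\<close> and on \<^const>\<open>is_degree\<close>
  make the function total.
\<close>

function z_elem :: "nat \<Rightarrow> (nat \<Rightarrow> int) \<Rightarrow> ((nat \<Rightarrow> int) \<Rightarrow> (nat \<Rightarrow> int))" where
  "z_elem n d =
     (if 3 \<le> n \<and> is_degree n d \<and> d \<noteq> 0
      then let \<alpha> = (SOME \<alpha>. maximal_root n d \<alpha>)
           in hecke_prod n (reflection n \<alpha>) (z_elem n (d - \<alpha>))
      else id)"
  by auto
termination
proof (relation "Wellfounded.measure (\<lambda>(n, d). height n d)")
  fix n :: nat and d \<alpha> :: "nat \<Rightarrow> int"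
  assume g: "3 \<le> n \<and> is_degree n d \<and> d \<noteq> 0" and \<alpha>: "\<alpha> = (SOME \<alpha>. maximal_root n d \<alpha>)"
  have "maximal_root n d (SOME \<alpha>. maximal_root n d \<alpha>)"
    by (rule someI_ex[of "maximal_root n d"], rule maximal_root_exists) (use g in auto)
  then have "maximal_root n d \<alpha>" by (simp only: \<alpha>)
  then show "((n, d - \<alpha>), n, d) \<in> Wellfounded.measure (\<lambda>(n, d). height n d)"
    using height_diff_maximal_root[of n d \<alpha>] g by (simp only: in_measure prod.case)
qed (rule wf_measure)

declare z_elem.simps [simp del]

end

theory Submission
  imports Defs
begin

text \<open>
  Cut the cycle at an index \<open>z\<close> with \<open>d z = 0\<close>.  The positive real roots below \<open>d\<close> are then segments
  of a path, and the maximal ones are the connected components of the support of \<open>d\<close>.  Let \<open>\<alpha>\<close> be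
  such a component and \<open>v\<close> any word in simple reflections that fix \<open>\<alpha>\<close> or belong to the end points
  of \<open>\<alpha>\<close>.  In the Hecke product \<open>s\<^sub>\<alpha> \<cdot> v\<close> the end point letters are absorbed, and the others multiply
  without loss of length.  Deleting the end points of \<open>\<alpha>\<close> from the later roots of the recursion for
  \<open>z\<^sub>d\<close> leaves again a recursion of this kind, for \<open>d - \<alpha>\<close> with the two end coefficients set to \<open>0\<close>,
  and all its roots are either strictly inside \<open>\<alpha>\<close> or disconnected from \<open>\<alpha>\<close>.  So the claim follows by
  induction on the number of steps.
\<close>

subsection \<open>Roots as vectors of norm two\<close>

locale affine_type_A =
  fixes n :: nat
  assumes n3: "3 \<le> n"
begin

abbreviation "form \<equiv> root_form n"
abbreviation "srefl \<equiv> simple_reflection n"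

section \<open>The form as a quadratic form of differences around the cycle\<close>

lemma adjacent_sym: "adjacent n i j = adjacent n j i"
  by (auto simp: adjacent_def)

lemma form_sym: "form a b = form b a"
proof -
  have "cartan n i j = cartan n j i" for i j
    using adjacent_sym by (auto simp: cartan_def)
  then show ?thesis
    unfolding root_form_def by (subst sum.swap) (simp add: mult.commute mult.left_commute)
qed

lemma form_diff_scale: "form (\<lambda>k. a k - c * b k) x = form a x - c * form b x"
  by (simp add: root_form_def algebra_simps sum_subtractf sum_distrib_left)

lemma form_diff_scale_right: "form x (\<lambda>k. a k - c * b k) = form x a - c * form x b"
  using form_diff_scale form_sym by simp

lemma pred_mod_eq: "i < n \<Longrightarrow> j < n \<Longrightarrow> i = Suc j mod n \<longleftrightarrow> j = (i + n - 1) mod n"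
  by (cases "i = 0"; cases "Suc j = n") (auto simp: mod_if)

text \<open>Since n \<ge> 3, the successor and the predecessor of i are distinct, so each
  contributes its own -1. For n = 2 they would coincide and the right-hand side would give
  -2.\<close>

lemma cartan_eq:
  assumes "i < n" "j < n"
  shows "cartan n i j = 2 * (if j = i then 1 else 0) - (if j = Suc i mod n then 1 else 0)
    - (if j = (i + n - 1) mod n then 1 else 0)"
  using assms n3 by (auto simp: cartan_def adjacent_def pred_mod_eq[symmetric] mod_if split: if_splits)

lemma form_eq: "form a b = (\<Sum>i<n. a i * (2 * b i - b (Suc i mod n) - b ((i + n - 1) mod n)))"
proof -
  have "(\<Sum>j<n. a i * b j * cartan n i j)
      = a i * (2 * b i - b (Suc i mod n) - b ((i + n - 1) mod n))" if "i < n" for i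
  proof -
    have "(\<Sum>j<n. a i * b j * cartan n i j) = (\<Sum>j<n. (if j = i then 2 * (a i * b j) else 0)
       - (if j = Suc i mod n then a i * b j else 0) - (if j = (i + n - 1) mod n then a i * b j else 0))"
      by (rule sum.cong[OF refl]) (use that in \<open>auto simp: cartan_eq\<close>)
    also have "\<dots> = a i * (2 * b i - b (Suc i mod n) - b ((i + n - 1) mod n))"
      using that n3 by (simp add: sum_subtractf) (simp add: algebra_simps)
    finally show ?thesis .
  qed
  then show ?thesis by (simp add: root_form_def)
qed

lemma form_simple_root:
  assumes "i < n"
  shows "form (simple_root i) b = 2 * b i - b (Suc i mod n) - b ((i + n - 1) mod n)"
proof -
  have "form (simple_root i) b
      = (\<Sum>k<n. if k = i then 2 * b k - b (Suc k mod n) - b ((k + n - 1) mod n) else 0)"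
    unfolding form_eq by (rule sum.cong) (auto simp: simple_root_def)
  then show ?thesis using assms by simp
qed

lemma sum_rotate: "(\<Sum>i<n. f (Suc i mod n)) = (\<Sum>i<n. f i :: int)"
proof -
  obtain m where m: "n = Suc m" using n3 by (cases n) auto
  have "(\<Sum>i<n. f (Suc i mod n)) = (\<Sum>i<m. f (Suc i)) + f 0"
    unfolding m by (subst sum.lessThan_Suc) simp
  also have "\<dots> = (\<Sum>i<n. f i)"
    unfolding m by (subst sum.lessThan_Suc_shift) simp
  finally show ?thesis .
qed

text \<open>Summation by parts around the cycle: both mixed terms become the same sum after a
  rotation of the index, and the squares are complete.\<close>

lemma norm_eq: "form b b = (\<Sum>i<n. (b (Suc i mod n) - b i)\<^sup>2)"
proof -
  have "(\<Sum>i<n. b i * b ((i + n - 1) mod n))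
      = (\<Sum>i<n. b (Suc i mod n) * b ((Suc i mod n + n - 1) mod n))"
    by (rule sum_rotate[symmetric, of "\<lambda>i. b i * b ((i + n - 1) mod n)"])
  also have "\<dots> = (\<Sum>i<n. b (Suc i mod n) * b i)"
  proof (rule sum.cong[OF refl])
    fix i assume "i \<in> {..<n}"
    then have "(Suc i mod n + n - 1) mod n = i"
      using pred_mod_eq[of "Suc i mod n" i] by simp
    then show "b (Suc i mod n) * b ((Suc i mod n + n - 1) mod n) = b (Suc i mod n) * b i" by simp
  qed
  finally have 1: "(\<Sum>i<n. b i * b ((i + n - 1) mod n)) = (\<Sum>i<n. b (Suc i mod n) * b i)" .
  have 2: "(\<Sum>i<n. (b (Suc i mod n))\<^sup>2) = (\<Sum>i<n. (b i)\<^sup>2)"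
    by (rule sum_rotate)
  have "form b b = 2 * (\<Sum>i<n. (b i)\<^sup>2) - (\<Sum>i<n. b (Suc i mod n) * b i)
      - (\<Sum>i<n. b i * b ((i + n - 1) mod n))"
    unfolding form_eq
    by (simp add: right_diff_distrib sum_subtractf sum_distrib_left power2_eq_square mult_ac)
  also have "\<dots> = (\<Sum>i<n. (b (Suc i mod n))\<^sup>2) + (\<Sum>i<n. (b i)\<^sup>2) - 2 * (\<Sum>i<n. b (Suc i mod n) * b i)"
    by (simp only: 1 2)
  also have "\<dots> = (\<Sum>i<n. (b (Suc i mod n) - b i)\<^sup>2)"
    by (simp add: power2_diff sum.distrib sum_subtractf sum_distrib_left mult.assoc)
  finally show ?thesis .
qed

text \<open>Given by the norm rather than by the list of real roots, so that stability under
  reflections follows from their being isometries that preserve the lattice.\<close>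

definition roots :: "(nat \<Rightarrow> int) set" where
  "roots = {b \<in> root_lattice n. form b b = 2}"

text \<open>A path between two indices and the complementary path around the cycle both have total
  squared variation at least the difference of the values, and the two sum up to the norm \<open>2\<close>.\<close>

lemma root_values_close:
  assumes "b \<in> roots" "i < n" "j < n"
  shows "\<bar>b i - b j\<bar> \<le> 1"
proof -
  have main: "\<bar>b i - b j\<bar> \<le> 1" if "i \<le> j" "j < n" for i j
  proof -
    \<comment> \<open>\<open>c\<close> continues b periodically; \<open>c n = c 0\<close> closes the
      second path, which runs from j through n = 0 to i.\<close>
    define c where "c k = b (k mod n)" for k
    define f where "f k = c (Suc k) - c k" for k
    have step: "(\<Sum>k\<in>{u..<v}. f k) = c v - c u" if "u \<le> v" for u v
      unfolding f_def using sum_Suc_diff'[OF that, of c] .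
    \<comment> \<open>Integrality enters here: an integer is at most its square in absolute
      value.\<close>
    have abs_le: "\<bar>\<Sum>k\<in>A. f k\<bar> \<le> (\<Sum>k\<in>A. (f k)\<^sup>2)" for A
    proof -
      have "\<bar>\<Sum>k\<in>A. f k\<bar> \<le> (\<Sum>k\<in>A. \<bar>f k\<bar>)" by (rule sum_abs)
      also have "\<dots> \<le> (\<Sum>k\<in>A. (f k)\<^sup>2)"
      proof (rule sum_mono)
        fix k
        have "\<bar>x\<bar> \<le> x\<^sup>2" for x :: int
          using self_le_power[of "\<bar>x\<bar>" 2] by (cases "x = 0") auto
        then show "\<bar>f k\<bar> \<le> (f k)\<^sup>2" .
      qed
      finally show ?thesis .
    qed
    have "2 = form b b" using assms(1) by (simp add: roots_def)
    also have "\<dots> = (\<Sum>k\<in>{0..<n}. (f k)\<^sup>2)"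
      unfolding norm_eq f_def c_def lessThan_atLeast0 by (rule sum.cong) auto
    also have "\<dots> = (\<Sum>k\<in>{0..<i}. (f k)\<^sup>2) + (\<Sum>k\<in>{i..<j}. (f k)\<^sup>2) + (\<Sum>k\<in>{j..<n}. (f k)\<^sup>2)"
      using that by (simp add: sum.atLeastLessThan_concat)
    finally have tot: "2 = \<dots>" .
    have "\<bar>c i - c 0\<bar> \<le> (\<Sum>k\<in>{0..<i}. (f k)\<^sup>2)" "\<bar>c j - c i\<bar> \<le> (\<Sum>k\<in>{i..<j}. (f k)\<^sup>2)"
      "\<bar>c n - c j\<bar> \<le> (\<Sum>k\<in>{j..<n}. (f k)\<^sup>2)"
      using abs_le[of "{0..<i}"] abs_le[of "{i..<j}"] abs_le[of "{j..<n}"] step that by auto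
    moreover have "c n = c 0" "c i = b i" "c j = b j" using that by (auto simp: c_def)
    ultimately show ?thesis using tot by linarith
  qed
  show ?thesis using main[of i j] main[of j i] assms by (cases "i \<le> j") auto
qed

text \<open>A negative coefficient is at most -1, and every other coefficient differs from it by at
  most 1.\<close>

lemma root_sign:
  assumes "b \<in> roots" "\<not> 0 \<le> b"
  shows "b \<le> 0"
proof -
  obtain i where i: "b i < 0" using assms(2) by (auto simp: le_fun_def not_le)
  have out: "b k = 0" if "\<not> k < n" for k using assms(1) that by (auto simp: roots_def root_lattice_def)
  have "i < n" using i out[of i] by fastforce
  have "b k \<le> 0" for k
    using root_values_close[OF assms(1) \<open>i < n\<close>, of k] i out[of k] by (cases "k < n") auto
  then show ?thesis by (simp add: le_fun_def)
qed

lemma simple_root_norm: "i < n \<Longrightarrow> form (simple_root i) (simple_root i) = 2"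
  using n3 by (simp add: form_simple_root) (auto simp: simple_root_def mod_if)

lemma simple_root_root: "i < n \<Longrightarrow> simple_root i \<in> roots"
  using simple_root_norm by (auto simp: roots_def root_lattice_def) (simp add: simple_root_def)

lemma simple_root_nonneg: "0 \<le> simple_root i"
  by (auto simp: simple_root_def le_fun_def)

lemma root_uminus: "b \<in> roots \<Longrightarrow> (\<lambda>k. - b k) \<in> roots"
  using form_diff_scale[of "\<lambda>k. 0" 1 b] form_diff_scale_right[of _ "\<lambda>k. 0" 1 b]
  by (auto simp: roots_def root_lattice_def root_form_def)

lemma root_nonzero: "b \<in> roots \<Longrightarrow> \<not> (0 \<le> b \<and> b \<le> 0)"
  by (auto simp: roots_def root_form_def dest!: antisym)

lemma root_sign_iff: "b \<in> roots \<Longrightarrow> (b \<le> 0) = (\<not> 0 \<le> b)"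
  using root_sign root_nonzero by blast

section \<open>Reflections as linear isometries, and their effect on signs of roots\<close>

lemma reflection_isometry:
  assumes "form a a = 2"
  shows "form (reflection n a x) (reflection n a y) = form x y"
  unfolding reflection_def
  using assms form_sym[of a y]
  by (simp add: form_diff_scale form_diff_scale_right right_diff_distrib left_diff_distrib)

lemma reflection_involution:
  assumes "form a a = 2"
  shows "reflection n a (reflection n a x) = x"
  unfolding reflection_def using assms by (simp add: form_diff_scale)

lemma reflection_linear:
  "reflection n a (\<lambda>k. x k - c * y k) = (\<lambda>k. reflection n a x k - c * reflection n a y k)"
  unfolding reflection_def by (auto simp: form_diff_scale algebra_simps fun_eq_iff)

lemma reflection_root:
  assumes "a \<in> roots" "b \<in> roots"
  shows "reflection n a b \<in> roots"
  using assms reflection_isometry[of a b b]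
  by (auto simp: roots_def root_lattice_def) (auto simp: reflection_def)

lemma srefl_involution: "i < n \<Longrightarrow> srefl i (srefl i x) = x"
  unfolding simple_reflection_def by (rule reflection_involution[OF simple_root_norm])

lemma srefl_comp_srefl: "i < n \<Longrightarrow> srefl i \<circ> srefl i = id"
  by (auto simp: srefl_involution)

lemma srefl_simple_root: "i < n \<Longrightarrow> srefl i (simple_root i) = (\<lambda>k. - simple_root i k)"
  by (auto simp: simple_reflection_def reflection_def simple_root_norm)

lemma srefl_apply_other: "k \<noteq> i \<Longrightarrow> srefl i x k = x k"
  by (simp add: simple_reflection_def reflection_def simple_root_def)

lemma srefl_root: "i < n \<Longrightarrow> b \<in> roots \<Longrightarrow> srefl i b \<in> roots"
  unfolding simple_reflection_def by (intro reflection_root simple_root_root)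

text \<open>A simple reflection changes only the coefficient at i. If the sign of the root flips,
  all other coefficients are both \<ge> 0 and \<le> 0, so b is a multiple of the simple root, and
  norm two leaves only the multiple 1.\<close>

lemma srefl_makes_negative:
  assumes "i < n" "b \<in> roots" "0 \<le> b" "\<not> 0 \<le> srefl i b"
  shows "b = simple_root i"
proof -
  have "srefl i b \<le> 0" using assms root_sign srefl_root by blast
  have z: "b k = 0" if "k \<noteq> i" for k
  proof -
    have "b k \<le> 0" using \<open>srefl i b \<le> 0\<close> srefl_apply_other[OF that, of b] by (metis le_fun_def zero_fun_apply)
    then show ?thesis using assms(3) by (auto simp: le_fun_def intro: antisym)
  qed
  \<comment> \<open>The multiple is written in the shape in which linearity of the form is
    stated.\<close>
  have b: "b = (\<lambda>k. 0 - (- b i) * simple_root i k)" using z by (auto simp: simple_root_def fun_eq_iff)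
  have "form b b = form b (\<lambda>k. 0 - (- b i) * simple_root i k)" by (subst (2) b) simp
  also have "\<dots> = b i * form b (simple_root i)"
    by (simp only: form_diff_scale_right) (simp add: root_form_def)
  also have "form b (simple_root i) = 2 * b i"
    by (subst b) (simp only: form_diff_scale, simp add: simple_root_norm assms, simp add: root_form_def)
  finally have "b i * b i = 1" using assms(2) by (simp add: roots_def)
  then have "b i = 1" using assms(3) by (auto simp: le_fun_def zmult_eq_1_iff) (metis le_minus_one_simps(3))
  then show ?thesis using z by (auto simp: simple_root_def fun_eq_iff)
qed

subsection \<open>The Weyl group and its length function\<close>

definition weyl :: "((nat \<Rightarrow> int) \<Rightarrow> (nat \<Rightarrow> int)) set" where
  "weyl = word_prod n ` {ws. set ws \<subseteq> {..<n}}"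

lemma word_prod_Nil [simp]: "word_prod n [] = id"
  by (simp add: word_prod_def)

lemma word_prod_Cons [simp]: "word_prod n (i # ws) = srefl i \<circ> word_prod n ws"
  by (simp add: word_prod_def)

lemma word_prod_append: "word_prod n (us @ ws) = word_prod n us \<circ> word_prod n ws"
  by (induction us) (auto simp: comp_assoc)

lemma word_prod_rev: "set ws \<subseteq> {..<n} \<Longrightarrow> word_prod n (rev ws) \<circ> word_prod n ws = id"
  by (induction ws) (auto simp: word_prod_append fun_eq_iff srefl_involution)

lemma weylI: "set ws \<subseteq> {..<n} \<Longrightarrow> word_prod n ws \<in> weyl"
  by (auto simp: weyl_def)

lemma weylE:
  assumes "w \<in> weyl"
  obtains ws where "set ws \<subseteq> {..<n}" "w = word_prod n ws"
  using assms by (auto simp: weyl_def)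

lemma id_weyl: "id \<in> weyl"
  using weylI[of "[]"] by simp

lemma comp_weyl: "u \<in> weyl \<Longrightarrow> w \<in> weyl \<Longrightarrow> u \<circ> w \<in> weyl"
  by (metis weylE weylI word_prod_append set_append Un_least)

lemma srefl_weyl: "i < n \<Longrightarrow> srefl i \<in> weyl"
  using weylI[of "[i]"] by simp

lemma word_prod_inv:
  assumes "set ws \<subseteq> {..<n}"
  shows "inv (word_prod n ws) = word_prod n (rev ws)"
  by (rule inv_unique_comp) (use word_prod_rev[of ws] word_prod_rev[of "rev ws"] assms in auto)

lemma weyl_bij: "w \<in> weyl \<Longrightarrow> bij w"
  by (metis o_bij rev_rev_ident set_rev weylE word_prod_rev)

lemma inv_weyl: "w \<in> weyl \<Longrightarrow> inv w \<in> weyl"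
  by (metis set_rev weylE weylI word_prod_inv)

lemma weyl_linear:
  "w \<in> weyl \<Longrightarrow> w (\<lambda>k. x k - c * y k) = (\<lambda>k. w x k - c * w y k)"
proof (elim weylE, hypsubst)
  fix ws
  show "word_prod n ws (\<lambda>k. x k - c * y k) = (\<lambda>k. word_prod n ws x k - c * word_prod n ws y k)"
    by (induction ws) (simp_all add: simple_reflection_def reflection_linear)
qed

lemma weyl_isometry: "w \<in> weyl \<Longrightarrow> form (w x) (w y) = form x y"
proof (elim weylE, hypsubst)
  fix ws assume "set ws \<subseteq> {..<n}"
  then show "form (word_prod n ws x) (word_prod n ws y) = form x y"
    by (induction ws) (simp_all add: simple_reflection_def reflection_isometry simple_root_norm)
qed

lemma weyl_root: "w \<in> weyl \<Longrightarrow> b \<in> roots \<Longrightarrow> w b \<in> roots"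
proof (elim weylE, hypsubst)
  fix ws assume "set ws \<subseteq> {..<n}" "b \<in> roots"
  then show "word_prod n ws b \<in> roots"
    by (induction ws) (simp_all add: srefl_root)
qed

lemma weyl_uminus: "w \<in> weyl \<Longrightarrow> w (\<lambda>k. - x k) = (\<lambda>k. - w x k)"
proof -
  assume w: "w \<in> weyl"
  have "(\<lambda>k. - x k) = (\<lambda>k. x k - 2 * x k)" by auto
  then show ?thesis by (simp only: weyl_linear[OF w]) auto
qed

lemma weyl_conj_reflection: "w \<in> weyl \<Longrightarrow> w \<circ> reflection n x = reflection n (w x) \<circ> w"
  by (auto simp: fun_eq_iff weyl_isometry)
    (simp add: reflection_def weyl_linear weyl_isometry)

lemma weyl_conj_srefl: "w \<in> weyl \<Longrightarrow> w \<circ> srefl i = reflection n (w (simple_root i)) \<circ> w"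
  unfolding simple_reflection_def by (rule weyl_conj_reflection)

text \<open>Apply the letters one after the other to the simple root. At the letter j where the sign
  turns negative, the root was \<alpha>_j. Conjugation then gives s_j w = w s_i for the part w of
  the word to the right of j, so multiplying by s_i cancels this letter.\<close>

lemma exchange:
  assumes "set ws \<subseteq> {..<n}" "i < n" "\<not> 0 \<le> word_prod n ws (simple_root i)"
  shows "\<exists>vs. set vs \<subseteq> {..<n} \<and> Suc (length vs) = length ws \<and> word_prod n vs = word_prod n ws \<circ> srefl i"
  using assms
proof (induction ws)
  case Nil
  then show ?case using simple_root_nonneg[of i] by (metis word_prod_Nil id_apply)
next
  case (Cons j ws)
  let ?b = "word_prod n ws (simple_root i)"
  show ?case
  proof (cases "0 \<le> ?b")
    case False
    have "set ws \<subseteq> {..<n}" using Cons.prems by auto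
    from Cons.IH[OF this Cons.prems(2) False] obtain vs where "set vs \<subseteq> {..<n}"
      "Suc (length vs) = length ws" "word_prod n vs = word_prod n ws \<circ> srefl i" by blast
    then show ?thesis using Cons.prems by (intro exI[of _ "j # vs"]) (auto simp: comp_assoc)
  next
    case True
    have w: "word_prod n ws \<in> weyl" using Cons.prems by (auto intro: weylI)
    have neg: "\<not> 0 \<le> srefl j ?b" using Cons.prems(3) unfolding word_prod_Cons comp_apply .
    have "?b = simple_root j"
      by (rule srefl_makes_negative[OF _ weyl_root[OF w simple_root_root[OF Cons.prems(2)]] True neg])
        (use Cons.prems in simp)
    then have "word_prod n ws \<circ> srefl i = srefl j \<circ> word_prod n ws"
      using weyl_conj_srefl[OF w, of i] by (simp add: simple_reflection_def)
    then have "word_prod n (j # ws) \<circ> srefl i = srefl j \<circ> srefl j \<circ> word_prod n ws"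
      by (simp add: comp_assoc)
    also have "\<dots> = word_prod n ws" using Cons.prems(1) srefl_comp_srefl[of j] by simp
    finally have "word_prod n ws = word_prod n (j # ws) \<circ> srefl i" ..
    moreover have "set ws \<subseteq> {..<n}" "Suc (length ws) = length (j # ws)" using Cons.prems(1) by auto
    ultimately show ?thesis by blast
  qed
qed

section \<open>Length and the sign test for ascents and descents\<close>

abbreviation "len \<equiv> weyl_length n"

lemma reduced_exists:
  assumes "w \<in> weyl"
  shows "\<exists>ws. reduced_expression n w ws"
proof -
  have "\<exists>k ws. set ws \<subseteq> {..<n} \<and> length ws = k \<and> word_prod n ws = w"
    using assms by (auto elim: weylE)
  from LeastI_ex[OF this] show ?thesis
    unfolding reduced_expression_def weyl_length_def by auto
qed

lemma len_le: "set ws \<subseteq> {..<n} \<Longrightarrow> len (word_prod n ws) \<le> length ws"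
  unfolding weyl_length_def by (rule Least_le) blast

lemma len_id: "len id = 0"
  using len_le[of "[]"] by simp

lemma len_srefl_le:
  assumes "w \<in> weyl" "i < n"
  shows "len (w \<circ> srefl i) \<le> Suc (len w)"
proof -
  obtain ws where "reduced_expression n w ws" using reduced_exists assms by blast
  then show ?thesis using len_le[of "ws @ [i]"] assms
    by (auto simp: reduced_expression_def word_prod_append)
qed

lemma len_descent:
  assumes "w \<in> weyl" "i < n" "\<not> 0 \<le> w (simple_root i)"
  shows "len w = Suc (len (w \<circ> srefl i))"
proof (rule antisym)
  obtain ws where "reduced_expression n w ws" using reduced_exists assms by blast
  then show "Suc (len (w \<circ> srefl i)) \<le> len w"
    using exchange[of ws i] len_le assms unfolding reduced_expression_def by (metis Suc_le_mono)
  have "w = (w \<circ> srefl i) \<circ> srefl i" using srefl_comp_srefl[OF assms(2)] by (simp add: comp_assoc)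
  then show "len w \<le> Suc (len (w \<circ> srefl i))"
    using len_srefl_le[of "w \<circ> srefl i" i] comp_weyl srefl_weyl assms by metis
qed

lemma len_ascent:
  assumes "w \<in> weyl" "i < n" "0 \<le> w (simple_root i)"
  shows "len (w \<circ> srefl i) = Suc (len w)"
proof -
  have "\<not> 0 \<le> (\<lambda>k. - w (simple_root i) k)"
    using assms(3) root_nonzero[OF weyl_root[OF assms(1) simple_root_root[OF assms(2)]]]
    by (auto simp: le_fun_def)
  then have "\<not> 0 \<le> (w \<circ> srefl i) (simple_root i)"
    using assms by (simp add: srefl_simple_root weyl_uminus)
  moreover have "w = (w \<circ> srefl i) \<circ> srefl i" using srefl_comp_srefl[OF assms(2)] by (simp add: comp_assoc)
  ultimately show ?thesis using len_descent[of "w \<circ> srefl i" i] comp_weyl srefl_weyl assms by metis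
qed

lemma len_inv:
  assumes "w \<in> weyl"
  shows "len (inv w) = len w"
proof -
  have le: "len (inv u) \<le> len u" if u: "u \<in> weyl" for u
  proof -
    obtain ws where "reduced_expression n u ws" using reduced_exists[OF u] by blast
    then show ?thesis using len_le[of "rev ws"] word_prod_inv[of ws] by (auto simp: reduced_expression_def)
  qed
  show ?thesis using le[OF assms] le[OF inv_weyl[OF assms]] weyl_bij[OF assms] by (simp add: inv_inv_eq)
qed

lemma inv_comp_srefl:
  assumes "w \<in> weyl" "i < n"
  shows "inv (srefl i \<circ> w) = inv w \<circ> srefl i"
proof -
  obtain ws where ws: "set ws \<subseteq> {..<n}" "w = word_prod n ws" using assms weylE by blast
  have "inv (srefl i \<circ> w) = word_prod n (rev (i # ws))"
    using ws assms word_prod_inv[of "i # ws"] by simp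
  then show ?thesis using ws by (simp add: word_prod_append word_prod_inv)
qed

lemma len_ascent_left:
  assumes "w \<in> weyl" "i < n" "0 \<le> inv w (simple_root i)"
  shows "len (srefl i \<circ> w) = Suc (len w)"
  using len_ascent[OF inv_weyl[OF assms(1)] assms(2,3)] inv_comp_srefl[OF assms(1,2)]
    len_inv[OF assms(1)] len_inv[OF comp_weyl[OF srefl_weyl[OF assms(2)] assms(1)]] by simp

subsection \<open>Demazure products\<close>

lemma hecke_simple_eq:
  assumes "u \<in> weyl" "i < n"
  shows "hecke_simple n u i = (if 0 \<le> u (simple_root i) then u \<circ> srefl i else u)"
  using len_ascent[OF assms] len_descent[OF assms] by (auto simp: hecke_simple_def)

lemma hecke_simple_weyl: "u \<in> weyl \<Longrightarrow> i < n \<Longrightarrow> hecke_simple n u i \<in> weyl"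
  by (simp add: hecke_simple_eq comp_weyl srefl_weyl)

text \<open>The left-handed counterpart of \<open>hecke_simple\<close>. The condition is the sign
  test for an ascent on the left; in this form it can be compared with the sign test on the
  right.\<close>

definition hecke_left :: "nat \<Rightarrow> ((nat \<Rightarrow> int) \<Rightarrow> (nat \<Rightarrow> int)) \<Rightarrow> ((nat \<Rightarrow> int) \<Rightarrow> (nat \<Rightarrow> int))" where
  "hecke_left i u = (if 0 \<le> inv u (simple_root i) then srefl i \<circ> u else u)"

lemma inv_srefl_comp:
  assumes "w \<in> weyl" "i < n"
  shows "inv (w \<circ> srefl i) = srefl i \<circ> inv w"
proof -
  obtain ws where ws: "set ws \<subseteq> {..<n}" "w = word_prod n ws" using assms weylE by blast
  have "inv (w \<circ> srefl i) = word_prod n (rev (ws @ [i]))"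
    using ws assms word_prod_inv[of "ws @ [i]"] by (simp add: word_prod_append)
  then show ?thesis using ws by (simp add: word_prod_inv)
qed

lemma root_neg_iff:
  assumes "b \<in> roots"
  shows "0 \<le> (\<lambda>k. - b k) \<longleftrightarrow> \<not> 0 \<le> b"
  using root_sign_iff[OF assms] by (simp add: le_fun_def)

lemma srefl_makes_positive:
  assumes "i < n" "b \<in> roots" "\<not> 0 \<le> b" "0 \<le> srefl i b"
  shows "b = (\<lambda>k. - simple_root i k)"
proof -
  have "srefl i (\<lambda>k. - b k) = (\<lambda>k. - srefl i b k)"
    by (rule weyl_uminus[OF srefl_weyl[OF assms(1)]])
  then have "(\<lambda>k. - b k) = simple_root i"
    using srefl_makes_negative[of i "\<lambda>k. - b k"] assms root_neg_iff root_uminus srefl_root by metis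
  then show ?thesis by (auto simp: fun_eq_iff dest: spec) (metis minus_minus)
qed

text \<open>Put x = u \<alpha>_j and y = u^{-1} \<alpha>_i, the roots whose signs are tested.
  Multiplication by s_i on the left flips the sign of x only if x is \<alpha>_i or its negative,
  which means that y is \<alpha>_j or its negative. If x = \<alpha>_i, then s_i u = u s_j and both
  sides equal this element. If x is the negative of \<alpha>_i, both tests fail and u stays as it
  is. Otherwise the two tests do not influence each other.\<close>

lemma hecke_left_right_commute:
  assumes u: "u \<in> weyl" and i: "i < n" and j: "j < n"
  shows "hecke_simple n (hecke_left i u) j = hecke_left i (hecke_simple n u j)"
proof -
  let ?a = "simple_root i" and ?b = "simple_root j"
  let ?x = "u ?b" and ?y = "inv u ?a"
  have xr: "?x \<in> roots" "?y \<in> roots" using u i j inv_weyl simple_root_root weyl_root by auto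
  have su: "srefl i \<circ> u \<in> weyl" "u \<circ> srefl j \<in> weyl" using u i j comp_weyl srefl_weyl by auto
  have uinv: "u (inv u v) = v" "inv u (u v) = v" for v
    using weyl_bij[OF u] by (auto simp: bij_is_surj surj_f_inv_f bij_is_inj inv_f_f)
  have R0: "hecke_simple n u j = (if 0 \<le> ?x then u \<circ> srefl j else u)"
    using hecke_simple_eq[OF u j] .
  have R1: "hecke_simple n (srefl i \<circ> u) j
      = (if 0 \<le> srefl i ?x then srefl i \<circ> u \<circ> srefl j else srefl i \<circ> u)"
    using hecke_simple_eq[OF su(1) j] by simp
  have L1: "hecke_left i (u \<circ> srefl j)
      = (if 0 \<le> srefl j ?y then srefl i \<circ> (u \<circ> srefl j) else u \<circ> srefl j)"
    by (simp add: hecke_left_def inv_srefl_comp[OF u j])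
  consider "0 \<le> ?x" "0 \<le> ?y" "?x = ?a" | "0 \<le> ?x" "0 \<le> ?y" "?x \<noteq> ?a" | "0 \<le> ?x" "\<not> 0 \<le> ?y"
    | "\<not> 0 \<le> ?x" "0 \<le> ?y" | "\<not> 0 \<le> ?x" "\<not> 0 \<le> ?y" by blast
  then show ?thesis
  proof cases
    case 1
    have y: "?y = ?b" using 1(3) uinv(2)[of ?b] by simp
    have "\<not> 0 \<le> srefl i ?x" "\<not> 0 \<le> srefl j ?y"
      unfolding 1(3) y using i j srefl_simple_root root_neg_iff simple_root_root simple_root_nonneg by auto
    moreover have "u \<circ> srefl j = srefl i \<circ> u"
      using weyl_conj_srefl[OF u, of j] 1(3) by (simp add: simple_reflection_def)
    moreover have "hecke_left i u = srefl i \<circ> u" "hecke_simple n u j = u \<circ> srefl j"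
      using 1 R0 by (simp_all only: hecke_left_def if_True)
    ultimately show ?thesis using R1 L1 by metis
  next
    case 2
    then have "?y \<noteq> ?b" using uinv(1)[of ?a] by metis
    then have "0 \<le> srefl i ?x" "0 \<le> srefl j ?y" using srefl_makes_negative i j xr 2 by blast+
    then show ?thesis using 2
      by (simp only: R0 L1 if_True) (simp only: hecke_left_def R1 if_True comp_assoc)
  next
    case 3
    have "\<not> 0 \<le> srefl j ?y"
    proof
      assume "0 \<le> srefl j ?y"
      then have "?y = (\<lambda>k. - ?b k)" using srefl_makes_positive j xr 3 by blast
      then have "?a = (\<lambda>k. - ?x k)" using uinv(1)[of ?a] weyl_uminus[OF u] by metis
      then show False using root_neg_iff[OF xr(1)] 3(1) simple_root_nonneg[of i] by metis
    qed
    then show ?thesis using 3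
      by (simp only: R0 L1 if_True if_False) (simp only: hecke_left_def R0 if_True if_False)
  next
    case 4
    have "\<not> 0 \<le> srefl i ?x"
    proof
      assume "0 \<le> srefl i ?x"
      then have "?x = (\<lambda>k. - ?a k)" using srefl_makes_positive i xr 4 by blast
      then have "?b = (\<lambda>k. - ?y k)" using uinv(2)[of ?b] weyl_uminus[OF inv_weyl[OF u]] by metis
      then show False using root_neg_iff[OF xr(2)] 4(2) simple_root_nonneg[of j] by metis
    qed
    then show ?thesis using 4
      by (simp only: R0 if_False) (simp only: hecke_left_def R1 if_True if_False)
  next
    case 5
    then show ?thesis by (simp only: R0 if_False) (simp only: hecke_left_def R0 if_False)
  qed
qed

definition demazure :: "nat list \<Rightarrow> (nat \<Rightarrow> int) \<Rightarrow> (nat \<Rightarrow> int)" where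
  "demazure ws = foldl (hecke_simple n) id ws"

lemma foldl_hecke_weyl: "u \<in> weyl \<Longrightarrow> set ws \<subseteq> {..<n} \<Longrightarrow> foldl (hecke_simple n) u ws \<in> weyl"
  by (induction ws arbitrary: u) (auto simp: hecke_simple_weyl)

lemma demazure_weyl: "set ws \<subseteq> {..<n} \<Longrightarrow> demazure ws \<in> weyl"
  by (simp add: demazure_def foldl_hecke_weyl id_weyl)

lemma demazure_Nil [simp]: "demazure [] = id"
  by (simp add: demazure_def)

lemma demazure_append: "demazure (us @ ws) = foldl (hecke_simple n) (demazure us) ws"
  by (simp add: demazure_def)

lemma demazure_single: "i < n \<Longrightarrow> demazure [i] = srefl i"
  using simple_root_nonneg[of i] by (simp add: demazure_def hecke_simple_eq id_weyl del: id_apply) simp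

lemma foldl_hecke_left:
  "u \<in> weyl \<Longrightarrow> set ws \<subseteq> {..<n} \<Longrightarrow> i < n \<Longrightarrow>
    foldl (hecke_simple n) (hecke_left i u) ws = hecke_left i (foldl (hecke_simple n) u ws)"
  by (induction ws arbitrary: u) (auto simp: hecke_left_right_commute hecke_simple_weyl)

text \<open>By the commutation of left and right multiplication, the first letter may be applied
  last.\<close>

lemma demazure_Cons:
  assumes "set ws \<subseteq> {..<n}" "i < n"
  shows "demazure (i # ws) = hecke_left i (demazure ws)"
proof -
  have "hecke_left i id = srefl i"
    using simple_root_nonneg[of i] by (simp only: hecke_left_def inv_id id_apply if_True comp_id)
  then show ?thesis
    using foldl_hecke_left[OF id_weyl assms] demazure_single[OF assms(2)] by (simp add: demazure_def)
qed

lemma demazure_append_left: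
  "set us \<subseteq> {..<n} \<Longrightarrow> set ws \<subseteq> {..<n} \<Longrightarrow> demazure (us @ ws) = foldr hecke_left us (demazure ws)"
  by (induction us) (auto simp: demazure_Cons)

text \<open>Since left and right Hecke multiplication commute, a word may be replaced by any word with the
  same Demazure product, on either side.  This makes \<^const>\<open>hecke_prod\<close> independent of the
  chosen reduced expression.\<close>

lemma demazure_append_cong:
  assumes "set us \<subseteq> {..<n}" "set ws' \<subseteq> {..<n}" "set ws \<subseteq> {..<n}"
    and "demazure us = demazure us'" "demazure ws = demazure ws'"
  shows "demazure (us @ ws) = demazure (us' @ ws')"
proof -
  have "demazure (us @ ws) = demazure (us @ ws')" using assms by (simp add: demazure_append_left)
  also have "\<dots> = demazure (us' @ ws')" using assms by (simp add: demazure_append)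
  finally show ?thesis .
qed

lemma demazure_repeat:
  assumes "i < n"
  shows "demazure [i, i] = demazure [i]"
proof -
  have "\<not> 0 \<le> srefl i (simple_root i)"
    using assms srefl_simple_root root_neg_iff simple_root_root simple_root_nonneg by auto
  then show ?thesis
    using assms demazure_append[of "[i]" "[i]"] by (simp add: demazure_single hecke_simple_eq srefl_weyl)
qed

text \<open>Prefixes of a reduced word are reduced, so every letter is an ascent and no letter is
  dropped.\<close>

lemma demazure_reduced:
  assumes "reduced_expression n w ws"
  shows "demazure ws = w"
  using assms
proof (induction ws arbitrary: w rule: rev_induct)
  case Nil
  then show ?case by (simp add: reduced_expression_def)
next
  case (snoc i ws)
  let ?v = "word_prod n ws"
  have ws: "set ws \<subseteq> {..<n}" "i < n" and w: "w = ?v \<circ> srefl i" "len w = Suc (length ws)"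
    using snoc.prems by (auto simp: reduced_expression_def word_prod_append)
  have v: "?v \<in> weyl" using ws weylI by blast
  have "len w \<le> Suc (len ?v)" using len_srefl_le[OF v ws(2)] w by simp
  then have l: "len ?v = length ws" using len_le[OF ws(1)] w by simp
  then have "demazure ws = ?v" using snoc.IH ws by (simp add: reduced_expression_def)
  then show ?case using l w by (simp add: demazure_append hecke_simple_def)
qed

lemma hecke_prod_demazure:
  assumes "set us \<subseteq> {..<n}" "set ws \<subseteq> {..<n}"
  shows "hecke_prod n (demazure us) (demazure ws) = demazure (us @ ws)"
proof -
  define vs where "vs = (SOME vs. reduced_expression n (demazure ws) vs)"
  have vs: "reduced_expression n (demazure ws) vs"
    unfolding vs_def by (rule someI_ex[OF reduced_exists[OF demazure_weyl[OF assms(2)]]])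
  then have "set vs \<subseteq> {..<n}" by (simp add: reduced_expression_def)
  have "hecke_prod n (demazure us) (demazure ws) = demazure (us @ vs)"
    by (simp add: hecke_prod_def demazure_append vs_def)
  also have "\<dots> = demazure (us @ ws)"
    by (rule demazure_append_cong) (use assms \<open>set vs \<subseteq> {..<n}\<close> demazure_reduced[OF vs] in auto)
  finally show ?thesis .
qed

text \<open>Each letter is either multiplied on or dropped. This carries properties of the letters,
  such as fixing a vector or leaving a coefficient alone, over to Demazure products.\<close>

lemma demazure_subword:
  assumes "set ws \<subseteq> {..<n}"
  obtains vs where "set vs \<subseteq> set ws" "demazure ws = word_prod n vs"
proof -
  have "\<exists>vs. set vs \<subseteq> set ws \<and> demazure ws = word_prod n vs"
    using assms
  proof (induction ws rule: rev_induct)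
    case (snoc i ws)
    then obtain vs where vs: "set vs \<subseteq> set ws" "demazure ws = word_prod n vs" by auto
    show ?case
    proof (cases "demazure (ws @ [i]) = demazure ws")
      case True
      then show ?thesis using vs by auto
    next
      case False
      then have "demazure (ws @ [i]) = word_prod n (vs @ [i])"
        using vs by (simp add: demazure_append hecke_simple_def word_prod_append split: if_splits)
      then show ?thesis using vs by (intro exI[of _ "vs @ [i]"]) auto
    qed
  qed simp
  then show ?thesis using that by blast
qed

lemma word_prod_fixes:
  "(\<And>i. i \<in> set ws \<Longrightarrow> form x (simple_root i) = 0) \<Longrightarrow> word_prod n ws x = x"
  by (induction ws) (auto simp: simple_reflection_def reflection_def)

lemma word_prod_apply_other: "k \<notin> set ws \<Longrightarrow> word_prod n ws x k = x k"
  by (induction ws) (auto simp: srefl_apply_other)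

end

subsection \<open>Segments of the cut cycle\<close>

lemma reflection_prod_Cons: "reflection_prod n (\<gamma> # \<gamma>s) = reflection n \<gamma> \<circ> reflection_prod n \<gamma>s"
  by (simp add: reflection_prod_def)

locale cut_affine_type_A = affine_type_A +
  fixes z :: nat
  assumes z_less: "z < n"
begin

text \<open>The cycle is read from \<open>z = \<sigma> 0 = \<sigma> n\<close> on, so that the proper arcs avoiding \<open>z\<close> are the
  images of the intervals in \<open>{1..<n}\<close>.\<close>

definition \<sigma> :: "nat \<Rightarrow> nat" where
  "\<sigma> p = (z + p) mod n"

definition seg :: "nat \<Rightarrow> nat \<Rightarrow> nat \<Rightarrow> int" where
  "seg a b = (\<lambda>k. if k \<in> \<sigma> ` {a..b} then 1 else 0)"

lemma \<sigma>_less [simp]: "\<sigma> p < n"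
  using n3 by (simp add: \<sigma>_def)

lemma \<sigma>_if: "p < n \<Longrightarrow> \<sigma> p = (if z + p < n then z + p else z + p - n)"
  using z_less by (auto simp: \<sigma>_def mod_if)

lemma \<sigma>_eq_iff: "p < n \<Longrightarrow> q < n \<Longrightarrow> \<sigma> p = \<sigma> q \<longleftrightarrow> p = q"
  using z_less by (auto simp: \<sigma>_if split: if_splits)

lemma \<sigma>_0: "\<sigma> 0 = z"
  using z_less by (simp add: \<sigma>_def)

lemma \<sigma>_n: "\<sigma> n = \<sigma> 0"
  by (simp add: \<sigma>_def)

lemma \<sigma>_Suc: "Suc (\<sigma> p) mod n = \<sigma> (Suc p)"
  by (simp add: \<sigma>_def mod_Suc_eq)

lemma \<sigma>_pred: "(\<sigma> (Suc p) + n - 1) mod n = \<sigma> p"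
  using pred_mod_eq[of "\<sigma> (Suc p)" "\<sigma> p"] \<sigma>_Suc[of p] by simp

lemma \<sigma>_surj:
  assumes "k < n"
  obtains p where "p < n" "k = \<sigma> p"
proof (cases "z \<le> k")
  case True
  then show ?thesis using assms that[of "k - z"] by (simp add: \<sigma>_if)
next
  case False
  then show ?thesis using assms that[of "k + n - z"] z_less by (simp add: \<sigma>_if)
qed

text \<open>The cut turns the cycle into a path: adjacency wraps around only through z, whose
  positions 0 and n are excluded.\<close>

lemma adjacent_\<sigma>:
  assumes "1 \<le> p" "p < n" "1 \<le> q" "q < n"
  shows "adjacent n (\<sigma> p) (\<sigma> q) \<longleftrightarrow> q = Suc p \<or> p = Suc q"
proof -
  have "\<sigma> q = \<sigma> (Suc p) \<longleftrightarrow> q = Suc p" if "1 \<le> q" "p < n" "q < n" for p q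
    using that \<sigma>_eq_iff[of q "Suc p"] \<sigma>_eq_iff[of q 0] \<sigma>_n by (cases "Suc p = n") auto
  then show ?thesis using assms by (simp add: adjacent_def \<sigma>_Suc)
qed

text \<open>The range includes q = n, a second position of z, so that the formula covers the right
  neighbour of every position below n.\<close>

lemma seg_apply:
  assumes "1 \<le> a" "b < n" "q \<le> n"
  shows "seg a b (\<sigma> q) = (if a \<le> q \<and> q \<le> b then 1 else 0)"
proof (cases "q = n")
  case True
  have "\<sigma> 0 \<noteq> \<sigma> p" if "p \<in> {a..b}" for p
    using \<sigma>_eq_iff[of 0 p] that assms by auto
  then have "\<sigma> 0 \<notin> \<sigma> ` {a..b}" by blast
  then show ?thesis using True assms by (simp add: seg_def \<sigma>_n)
next
  case False
  then have "\<sigma> q = \<sigma> p \<longleftrightarrow> q = p" if "p \<in> {a..b}" for p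
    using \<sigma>_eq_iff[of q p] that assms by auto
  then have "\<sigma> q \<in> \<sigma> ` {a..b} \<longleftrightarrow> q \<in> {a..b}" by blast
  then show ?thesis by (simp add: seg_def)
qed

lemma seg_out: "n \<le> k \<Longrightarrow> seg a b k = 0"
  using \<sigma>_less by (auto simp: seg_def not_less[symmetric] simp del: \<sigma>_less)

lemma seg_nonneg: "0 \<le> seg a b"
  by (auto simp: seg_def le_fun_def)

section \<open>Segments as roots, and the words of their reflections\<close>

lemma simple_root_\<sigma>: "simple_root (\<sigma> p) = seg p p"
  by (auto simp: simple_root_def seg_def)

lemma form_simple_seg:
  assumes "1 \<le> p" "p < n" "1 \<le> a" "b < n"
  shows "form (simple_root (\<sigma> p)) (seg a b) = 2 * (if a \<le> p \<and> p \<le> b then 1 else 0)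
    - (if a \<le> Suc p \<and> Suc p \<le> b then 1 else 0) - (if a \<le> p - 1 \<and> p - 1 \<le> b then 1 else 0)"
proof -
  obtain q where q: "p = Suc q" using assms by (cases p) auto
  show ?thesis unfolding q using assms q
    by (simp add: form_simple_root \<sigma>_Suc \<sigma>_pred[simplified] seg_apply)
qed

lemma eq_on_\<sigma>:
  assumes "\<And>p. p < n \<Longrightarrow> x (\<sigma> p) = y (\<sigma> p)" "\<And>k. n \<le> k \<Longrightarrow> x k = y k"
  shows "x = y"
  using assms \<sigma>_surj by (metis ext not_less)

lemma srefl_seg:
  assumes "1 \<le> a" "a < b" "b < n"
  shows "srefl (\<sigma> a) (seg (Suc a) b) = seg a b"
proof -
  have "form (seg (Suc a) b) (simple_root (\<sigma> a)) = -1"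
    using assms form_simple_seg[of a "Suc a" b] form_sym by simp
  then show ?thesis
    unfolding simple_reflection_def reflection_def using assms
    by (intro eq_on_\<sigma>) (auto simp: simple_root_\<sigma> seg_apply seg_out)
qed

lemma reflection_seg_simple_root:
  assumes "1 \<le> a" "a < b" "b < n"
  shows "reflection n (seg (Suc a) b) (simple_root (\<sigma> a)) = seg a b"
proof -
  have "form (simple_root (\<sigma> a)) (seg (Suc a) b) = -1"
    using assms form_simple_seg[of a "Suc a" b] by simp
  then show ?thesis
    unfolding reflection_def using assms
    by (intro eq_on_\<sigma>) (auto simp: simple_root_\<sigma> seg_apply seg_out)
qed

lemma seg_root:
  assumes "1 \<le> a" "a \<le> b" "b < n"
  shows "seg a b \<in> roots"
proof -
  have "1 \<le> a \<longrightarrow> seg a b \<in> roots"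
    using assms(2)
  proof (induction rule: inc_induct)
    case base
    then show ?case using simple_root_root[of "\<sigma> b"] by (simp add: simple_root_\<sigma>)
  next
    case (step a)
    then show ?case using srefl_seg[of a b] srefl_root[of "\<sigma> a" "seg (Suc a) b"] assms by simp
  qed
  then show ?thesis using assms by simp
qed

text \<open>The palindrome a, ..., b, ..., a with b once in the middle; it spells the reflection in
  the segment as a conjugate of the simple reflection at b. For b < a it is empty.\<close>

definition seg_path :: "nat \<times> nat \<Rightarrow> nat list" where
  "seg_path = (\<lambda>(a, b). [a..<Suc b] @ rev [a..<b])"

abbreviation "seg_word a b \<equiv> map \<sigma> (seg_path (a, b))"

lemma seg_path_step: "a < b \<Longrightarrow> seg_path (a, b) = a # seg_path (Suc a, b) @ [a]"
  by (simp add: seg_path_def upt_conv_Cons)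

lemma set_map_\<sigma> [simp]: "set (map \<sigma> ps) \<subseteq> {..<n}"
  by auto

text \<open>Downward induction on a. With u the reflection in \<open>seg (Suc a) b\<close>, the
  reflection in \<open>seg a b\<close> is s_a u s_a. Both multiplications are ascents: u sends
  \<alpha>_a to \<open>seg a b\<close>, and the inverse of u s_a sends \<alpha>_a to
  \<open>seg (Suc a) b\<close>; both are positive.\<close>

lemma demazure_seg_word:
  assumes "1 \<le> a" "a \<le> b" "b < n"
  shows "demazure (seg_word a b) = reflection n (seg a b)"
    and "len (reflection n (seg a b)) = 2 * (b - a) + 1"
proof -
  have "1 \<le> a \<longrightarrow> demazure (seg_word a b) = reflection n (seg a b) \<and>
      len (reflection n (seg a b)) = 2 * (b - a) + 1"
    using assms(2)
  proof (induction rule: inc_induct)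
    case base
    have "len (id \<circ> srefl (\<sigma> b)) = Suc (len id)"
      by (rule len_ascent[OF id_weyl]) (simp_all only: \<sigma>_less id_apply simple_root_nonneg)
    then show ?case
      using demazure_single[of "\<sigma> b"]
      by (simp add: seg_path_def simple_reflection_def simple_root_\<sigma> len_id)
  next
    case (step a)
    let ?u = "reflection n (seg (Suc a) b)" and ?i = "\<sigma> a"
    show ?case
    proof
      assume "1 \<le> a"
      note a = \<open>1 \<le> a\<close> \<open>a < b\<close> assms(3)
      have IH: "demazure (seg_word (Suc a) b) = ?u" "len ?u = 2 * (b - Suc a) + 1"
        using step by auto
      have u: "?u \<in> weyl" using demazure_weyl[OF set_map_\<sigma>, of "seg_path (Suc a, b)"] IH by simp
      have norm: "form (seg (Suc a) b) (seg (Suc a) b) = 2"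
        using seg_root[of "Suc a" b] a by (simp add: roots_def)
      have "?u \<circ> ?u = id" using reflection_involution[OF norm] by auto
      then have invu: "inv ?u = ?u" by (simp add: inv_unique_comp)
      have pos: "0 \<le> ?u (simple_root ?i)"
        using reflection_seg_simple_root[OF a] seg_nonneg by metis
      let ?w = "?u \<circ> srefl ?i"
      have w: "?w \<in> weyl" using u comp_weyl srefl_weyl \<sigma>_less by blast
      have "inv ?w (simple_root ?i) = srefl ?i (seg a b)"
        using inv_srefl_comp[OF u \<sigma>_less] invu reflection_seg_simple_root[OF a] by simp
      also have "\<dots> = seg (Suc a) b"
        using srefl_seg[OF a] srefl_involution[OF \<sigma>_less] by metis
      finally have pos': "0 \<le> inv ?w (simple_root ?i)" using seg_nonneg by metis
      have "srefl ?i \<circ> ?w = (srefl ?i \<circ> ?u) \<circ> srefl ?i" by (simp add: comp_assoc)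
      also have "\<dots> = reflection n (seg a b)"
        using weyl_conj_reflection[OF srefl_weyl[OF \<sigma>_less], of a "seg (Suc a) b"] srefl_seg[OF a]
          srefl_comp_srefl[OF \<sigma>_less, of a] by (simp add: comp_assoc)
      finally have prod: "srefl ?i \<circ> ?w = reflection n (seg a b)" .
      have "demazure (seg_word a b) = hecke_left ?i (demazure (seg_word (Suc a) b @ [?i]))"
        using a(2) demazure_Cons[of "seg_word (Suc a) b @ [?i]" ?i] by (simp add: seg_path_step image_subset_iff)
      also have "\<dots> = srefl ?i \<circ> ?w"
        using pos pos' by (simp add: demazure_append IH hecke_simple_eq[OF u \<sigma>_less] hecke_left_def del: comp_apply)
      finally have "demazure (seg_word a b) = reflection n (seg a b)" using prod by simp
      moreover have "len (reflection n (seg a b)) = 2 * (b - a) + 1"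
        using len_ascent_left[OF w \<sigma>_less pos'] len_ascent[OF u \<sigma>_less pos] prod IH a by simp
      ultimately show "demazure (seg_word a b) = reflection n (seg a b) \<and>
        len (reflection n (seg a b)) = 2 * (b - a) + 1" ..
    qed
  qed
  then show "demazure (seg_word a b) = reflection n (seg a b)"
    "len (reflection n (seg a b)) = 2 * (b - a) + 1" using assms by auto
qed

text \<open>The letters kept in v are orthogonal to the segment, so v fixes it, and the pairing of v
  \<alpha>_p with the segment is that of \<alpha>_p. For a kept letter p this pairing is 0, so the
  reflection does not change v \<alpha>_p, and the sign tests for v and for the whole product agree:
  both lengths grow together. An end point letter is a descent and is absorbed.\<close>

lemma reflection_seg_demazure:
  assumes ab: "1 \<le> a" "a \<le> b" "b < n"
    and ps: "\<And>p. p \<in> set ps \<Longrightarrow> 1 \<le> p \<and> p < n \<and> Suc p \<noteq> a \<and> p \<noteq> Suc b"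
  defines "v \<equiv> demazure (map \<sigma> (filter (\<lambda>p. p \<noteq> a \<and> p \<noteq> b) ps))"
  shows "foldl (hecke_simple n) (reflection n (seg a b)) (map \<sigma> ps) = reflection n (seg a b) \<circ> v"
    and "len (reflection n (seg a b) \<circ> v) = len (reflection n (seg a b)) + len v"
proof -
  let ?\<alpha> = "seg a b" and ?u = "reflection n (seg a b)"
  let ?J = "\<lambda>ps. map \<sigma> (filter (\<lambda>p. p \<noteq> a \<and> p \<noteq> b) ps)"
  have u: "?u \<in> weyl" using demazure_weyl[OF set_map_\<sigma>, of "seg_path (a, b)"] demazure_seg_word[OF ab] by simp
  have "foldl (hecke_simple n) ?u (map \<sigma> ps) = ?u \<circ> demazure (?J ps)
      \<and> len (?u \<circ> demazure (?J ps)) = len ?u + len (demazure (?J ps))"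
    using ps
  proof (induction ps rule: rev_induct)
    case Nil
    show ?case using len_id by (simp add: id_def)
  next
    case (snoc p ps)
    let ?v = "demazure (?J ps)" and ?i = "\<sigma> p"
    have IH: "foldl (hecke_simple n) ?u (map \<sigma> ps) = ?u \<circ> ?v" "len (?u \<circ> ?v) = len ?u + len ?v"
      using snoc.IH snoc.prems by (auto simp: o_def)
    have p: "1 \<le> p" "p < n" "Suc p \<noteq> a" "p \<noteq> Suc b" using snoc.prems[of p] by auto
    have v: "?v \<in> weyl" by (rule demazure_weyl[OF set_map_\<sigma>])
    have uv: "?u \<circ> ?v \<in> weyl" using u v comp_weyl by blast
    obtain vs where vs: "set vs \<subseteq> set (?J ps)" "?v = word_prod n vs"
      using demazure_subword[OF set_map_\<sigma>] .
    have J: "\<exists>q. i = \<sigma> q \<and> 1 \<le> q \<and> q < n \<and> Suc q \<noteq> a \<and> q \<noteq> Suc b \<and> q \<noteq> a \<and> q \<noteq> b"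
      if "i \<in> set vs" for i
    proof -
      have "i \<in> set (?J ps)" using that vs(1) by blast
      then obtain q where "i = \<sigma> q" "q \<in> set ps" "q \<noteq> a" "q \<noteq> b" by auto
      then show ?thesis using snoc.prems[of q] by auto
    qed
    have v\<alpha>: "?v ?\<alpha> = ?\<alpha>"
      unfolding vs(2)
    proof (rule word_prod_fixes)
      fix i assume "i \<in> set vs"
      from J[OF this] obtain q where "i = \<sigma> q" "1 \<le> q" "q < n" "Suc q \<noteq> a" "q \<noteq> Suc b" "q \<noteq> a" "q \<noteq> b"
        by blast
      then show "form ?\<alpha> (simple_root i) = 0"
        using form_simple_seg[of q a b] ab form_sym by auto
    qed
    have form_v: "form (?v (simple_root ?i)) ?\<alpha> = form (simple_root ?i) ?\<alpha>"
      using weyl_isometry[OF v, of "simple_root ?i" ?\<alpha>] v\<alpha> by simp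
    have step: "foldl (hecke_simple n) ?u (map \<sigma> (ps @ [p])) = hecke_simple n (?u \<circ> ?v) ?i"
      using IH(1) by simp
    show ?case
    proof (cases "p = a \<or> p = b")
      case True
      \<comment> \<open>The coefficient at the opposite end shows negativity. No end point letter
        occurs in v, so v does not touch it; the reflection makes it 0 - 1 if a < b, and 1 - 2 if a
        = b, where p = q.\<close>
      define q where "q = (if p = a then b else a)"
      have q: "q = a \<or> q = b" by (simp add: q_def)
      have "\<sigma> q \<notin> set vs"
      proof
        assume "\<sigma> q \<in> set vs"
        from J[OF this] obtain r where "\<sigma> q = \<sigma> r" "r < n" "r \<noteq> a" "r \<noteq> b" by blast
        then show False using q \<sigma>_eq_iff[of q r] ab by auto
      qed
      then have "?v (simple_root ?i) (\<sigma> q) = simple_root ?i (\<sigma> q)"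
        unfolding vs(2) by (rule word_prod_apply_other)
      then have "(?u \<circ> ?v) (simple_root ?i) (\<sigma> q)
          = simple_root ?i (\<sigma> q) - form (simple_root ?i) ?\<alpha> * ?\<alpha> (\<sigma> q)"
        unfolding comp_apply by (simp add: reflection_def form_v)
      also have "\<dots> < 0"
      proof -
        have "simple_root ?i (\<sigma> q) = (if p = q then 1 else 0)" "?\<alpha> (\<sigma> q) = 1"
          using q ab p by (auto simp: simple_root_\<sigma> seg_apply)
        moreover have "form (simple_root ?i) ?\<alpha> = (if a = b then 2 else 1)"
          using True form_simple_seg[OF p(1,2) ab(1,3)] ab by auto
        ultimately show ?thesis using True by (auto simp: q_def)
      qed
      finally have neg: "(?u \<circ> ?v) (simple_root ?i) (\<sigma> q) < 0" .
      have "\<not> 0 \<le> (?u \<circ> ?v) (simple_root ?i)"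
      proof
        assume "0 \<le> (?u \<circ> ?v) (simple_root ?i)"
        from le_funD[OF this, of "\<sigma> q"] neg show False unfolding zero_fun_apply by linarith
      qed
      then have 1: "hecke_simple n (?u \<circ> ?v) ?i = ?u \<circ> ?v"
        using hecke_simple_eq[OF uv \<sigma>_less, of p] by simp
      have 2: "?J (ps @ [p]) = ?J ps" using True by auto
      show ?thesis using IH(2) unfolding step 1 2 by blast
    next
      case False
      then have "form (simple_root ?i) ?\<alpha> = 0"
        using form_simple_seg[of p a b] p ab by auto
      then have "reflection n ?\<alpha> (?v (simple_root ?i)) = ?v (simple_root ?i)"
        by (simp add: reflection_def form_v)
      then have same: "(?u \<circ> ?v) (simple_root ?i) = ?v (simple_root ?i)" by simp
      have J': "demazure (?J (ps @ [p])) = hecke_simple n ?v ?i"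
        using False by (simp add: demazure_append)
      show ?thesis
      proof (cases "0 \<le> ?v (simple_root ?i)")
        case True
        have 1: "hecke_simple n (?u \<circ> ?v) ?i = ?u \<circ> ?v \<circ> srefl ?i"
          using hecke_simple_eq[OF uv \<sigma>_less, of p] same True by metis
        have 2: "hecke_simple n ?v ?i = ?v \<circ> srefl ?i"
          using hecke_simple_eq[OF v \<sigma>_less, of p] True by metis
        have "len (?u \<circ> ?v \<circ> srefl ?i) = Suc (len (?u \<circ> ?v))"
          using len_ascent[OF uv \<sigma>_less, of p] same True by metis
        moreover have "len (?v \<circ> srefl ?i) = Suc (len ?v)"
          using len_ascent[OF v \<sigma>_less, of p] True by metis
        ultimately show ?thesis
          using IH(2) unfolding step J' 1 2 comp_assoc by (intro conjI refl) linarith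
      next
        case False
        have 1: "hecke_simple n (?u \<circ> ?v) ?i = ?u \<circ> ?v"
          using hecke_simple_eq[OF uv \<sigma>_less, of p] same False by metis
        have 2: "hecke_simple n ?v ?i = ?v"
          using hecke_simple_eq[OF v \<sigma>_less, of p] False by metis
        show ?thesis using IH(2) unfolding step J' 1 2 by blast
      qed
    qed
  qed
  then show "foldl (hecke_simple n) ?u (map \<sigma> ps) = ?u \<circ> v" "len (?u \<circ> v) = len ?u + len v"
    unfolding v_def by blast+
qed

end

subsection \<open>Greedy decompositions\<close>

text \<open>\<open>e p\<close> plays the role of the coefficient of \<open>d\<close> at position \<open>p\<close>, with \<open>e 0 = 0\<close>.  Pairs with \<open>b < a\<close> are empty
  segments; they are skipped, since \<open>trim\<close> below produces them.  The list need not exhaust \<open>e\<close>.\<close>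

fun greedy :: "(nat \<Rightarrow> nat) \<Rightarrow> (nat \<times> nat) list \<Rightarrow> bool" where
  "greedy e [] = True"
| "greedy e ((a, b) # l) = (if b < a then greedy e l else
     (\<forall>p\<in>{a..b}. 0 < e p) \<and> e (a - 1) = 0 \<and> e (Suc b) = 0 \<and>
     greedy (\<lambda>p. if p \<in> {a..b} then e p - 1 else e p) l)"

text \<open>Deletes a and b from {c..d}. It is applied to intervals that avoid a - 1 and b + 1;
  these contain a or b only as an end point, so that moving the ends suffices. Then c = b forces the
  singleton {b}, and d = a the singleton {a}.\<close>

definition trim :: "nat \<Rightarrow> nat \<Rightarrow> nat \<times> nat \<Rightarrow> nat \<times> nat" where
  "trim a b = (\<lambda>(c, d). (if c = a \<or> c = b then Suc c else c, if d = a \<or> d = b then d - 1 else d))"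

lemma trim_interval:
  assumes "1 \<le> a" "a \<le> b" "c \<le> d" "a - 1 \<notin> {c..d}" "Suc b \<notin> {c..d}" "trim a b (c, d) = (c', d')"
  shows "{c'..d'} = {c..d} - {a, b}"
proof -
  have c': "c' = (if c = a \<or> c = b then Suc c else c)" and d': "d' = (if d = a \<or> d = b then d - 1 else d)"
    using assms(6) by (auto simp: trim_def)
  consider "d < a" | "Suc b < c" | "a \<le> c" "d \<le> b"
    using assms(1-5) by fastforce
  then show ?thesis
  proof cases
    case 3
    show ?thesis
    proof (intro set_eqI iffI)
      fix x assume "x \<in> {c'..d'}"
      then have "c' \<le> x" "x \<le> d'" by auto
      then show "x \<in> {c..d} - {a, b}"
        using 3 assms(1-3) by (cases "c = a"; cases "d = b") (auto simp: c' d' split: if_splits)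
    next
      fix x assume "x \<in> {c..d} - {a, b}"
      then show "x \<in> {c'..d'}"
        using 3 assms(1-3) by (auto simp: c' d')
    qed
  qed (use assms(1-3) in \<open>auto simp: c' d'\<close>)
qed

text \<open>The zeros at a - 1 and b + 1 force each nonempty segment to lie inside {a..b} or away
  from it, so \<open>trim_interval\<close> applies. A shortened segment ends next to a or b, where
  the new function is 0; an end that has not moved keeps its old zero neighbour. A segment that
  becomes empty changed the coefficients at a and b only.\<close>

lemma greedy_trim:
  assumes "greedy e l" "1 \<le> a" "a \<le> b" "e (a - 1) = 0" "e (Suc b) = 0" "e 0 = 0"
  shows "greedy (\<lambda>p. if p = a \<or> p = b then 0 else e p) (map (trim a b) l)"
  using assms
proof (induction l arbitrary: e)
  case (Cons cd l)
  obtain c d where cd: "cd = (c, d)" by fastforce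
  obtain c' d' where cd': "trim a b (c, d) = (c', d')" by fastforce
  show ?case
  proof (cases "d < c")
    case True
    then have "d' < c'" using cd' Cons.prems by (auto simp: trim_def split: if_splits)
    then show ?thesis using Cons True by (simp add: cd cd')
  next
    case False
    let ?f = "\<lambda>p. if p \<in> {c..d} then e p - 1 else e p"
    let ?z = "\<lambda>e p. if p = a \<or> p = b then (0::nat) else e p"
    have g: "\<And>p. p \<in> {c..d} \<Longrightarrow> 0 < e p" "e (c - 1) = 0" "e (Suc d) = 0" "greedy ?f l"
      using Cons.prems(1) False by (auto simp: cd)
    have out: "a - 1 \<notin> {c..d}" "Suc b \<notin> {c..d}" "0 \<notin> {c..d}"
      using g(1) Cons.prems(4-6) by (metis less_nat_zero_code)+
    have int: "{c'..d'} = {c..d} - {a, b}"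
      using trim_interval[OF Cons.prems(2,3) _ out(1,2) cd'] False by simp
    have IH: "greedy (?z ?f) (map (trim a b) l)"
      by (rule Cons.IH) (use g(4) Cons.prems out in auto)
    show ?thesis
    proof (cases "d' < c'")
      case True
      then have "{c..d} \<subseteq> {a, b}" using int by auto
      then have "?z ?f = ?z e" by (auto simp: fun_eq_iff)
      then show ?thesis using IH True by (simp add: cd cd')
    next
      case False
      have eq: "?z ?f = (\<lambda>p. if p \<in> {c'..d'} then ?z e p - 1 else ?z e p)"
        unfolding int by (auto simp: fun_eq_iff)
      have "?z e (c' - 1) = 0" "?z e (Suc d') = 0"
        using cd' g(2,3) Cons.prems(2,3) by (auto simp: trim_def split: if_splits)
      moreover have "\<forall>p\<in>{c'..d'}. 0 < ?z e p" using g(1) unfolding int by auto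
      ultimately show ?thesis using IH False unfolding eq by (simp add: cd cd')
    qed
  qed
qed simp

section \<open>From greedy lists to reduced products of reflections\<close>

context cut_affine_type_A
begin

text \<open>The function only decreases along the list, so a position used at any stage was positive
  at the start.\<close>

lemma greedy_path_positive:
  "greedy e l \<Longrightarrow> p \<in> set (concat (map seg_path l)) \<Longrightarrow> 0 < e p"
proof (induction l arbitrary: e)
  case (Cons ab l)
  obtain a b where ab: "ab = (a, b)" by fastforce
  show ?case
  proof (cases "b < a")
    case True
    then show ?thesis using Cons by (simp add: ab seg_path_def)
  next
    case False
    let ?f = "\<lambda>p. if p \<in> {a..b} then e p - 1 else e p"
    have g: "\<forall>p\<in>{a..b}. 0 < e p" "greedy ?f l" using Cons.prems False by (auto simp: ab)
    show ?thesis
    proof (cases "p \<in> {a..b}")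
      case True
      then show ?thesis using g by blast
    next
      case False
      then have "p \<in> set (concat (map seg_path l))" using Cons.prems(2) by (auto simp: ab seg_path_def)
      then show ?thesis using Cons.IH[OF g(2)] False by auto
    qed
  qed
qed simp

lemma filter_upt_interval:
  assumes "\<And>p. p \<in> {c'..<d'} \<longleftrightarrow> p \<in> {c..<d} \<and> P p"
  shows "filter P [c..<d] = [c'..<d']"
proof (rule sorted_distinct_set_unique)
  have "set (filter P [c..<d]) = {p. p \<in> {c..<d} \<and> P p}" by auto
  also have "\<dots> = {c'..<d'}" using assms by blast
  finally show "set (filter P [c..<d]) = set [c'..<d']" by simp
qed (simp_all add: sorted_wrt_filter)

text \<open>If the middle letter d of the palindrome survives, deleting a and b leaves the
  palindrome of the trimmed interval. If d is deleted, its lower neighbour, if any letter is left,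
  occurs twice in a row, and idempotence merges the two copies.\<close>

lemma demazure_trim:
  assumes "1 \<le> a" "a \<le> b" "c \<le> d" "a - 1 \<notin> {c..d}" "Suc b \<notin> {c..d}" "0 < c"
  shows "demazure (map \<sigma> (filter (\<lambda>p. p \<noteq> a \<and> p \<noteq> b) (seg_path (c, d))))
    = demazure (map \<sigma> (seg_path (trim a b (c, d))))"
proof -
  let ?P = "\<lambda>p. p \<noteq> a \<and> p \<noteq> b"
  obtain c' d' where cd': "trim a b (c, d) = (c', d')" by fastforce
  have int: "{c'..d'} = {c..d} - {a, b}" by (rule trim_interval) (use assms cd' in auto)
  have mem: "c' \<le> p \<and> p \<le> d' \<longleftrightarrow> c \<le> p \<and> p \<le> d \<and> p \<noteq> a \<and> p \<noteq> b" for p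
    using eqset_imp_iff[OF int, of p] by simp
  have 1: "filter ?P [c..<Suc d] = [c'..<Suc d']"
    by (rule filter_upt_interval) (use int in \<open>simp only: atLeastLessThanSuc_atLeastAtMost, blast\<close>)
  have c': "c' = (if c = a \<or> c = b then Suc c else c)" and d': "d' = (if d = a \<or> d = b then d - 1 else d)"
    using cd' by (auto simp: trim_def)
  show ?thesis
  proof (cases "d = a \<or> d = b")
    case False
    have "filter ?P [c..<d] = [c'..<d']"
    proof (rule filter_upt_interval)
      fix p
      show "p \<in> {c'..<d'} \<longleftrightarrow> p \<in> {c..<d} \<and> ?P p"
        using mem[of p] False d' by auto
    qed
    then have "filter ?P (seg_path (c, d)) = seg_path (c', d')"
      using 1 by (simp add: seg_path_def flip: rev_filter)
    then show ?thesis using cd' by simp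
  next
    case True
    then have d'': "d = Suc d'" using d' assms by auto
    have "filter ?P [c..<d] = [c'..<Suc d']"
    proof (rule filter_upt_interval)
      fix p
      show "p \<in> {c'..<Suc d'} \<longleftrightarrow> p \<in> {c..<d} \<and> ?P p"
        using mem[of p] True d'' by auto
    qed
    then have f: "filter ?P (seg_path (c, d)) = [c'..<Suc d'] @ rev [c'..<Suc d']"
      using 1 by (simp add: seg_path_def flip: rev_filter)
    show ?thesis
    proof (cases "c' \<le> d'")
      case False
      then show ?thesis unfolding f cd' by (simp add: seg_path_def)
    next
      case True
      let ?x = "map \<sigma> [c'..<d']" and ?y = "map \<sigma> (rev [c'..<d'])"
      have "demazure ([\<sigma> d', \<sigma> d'] @ ?y) = demazure ([\<sigma> d'] @ ?y)"
        by (rule demazure_append_cong) (auto simp: demazure_repeat)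
      then have "demazure (?x @ ([\<sigma> d', \<sigma> d'] @ ?y)) = demazure (?x @ ([\<sigma> d'] @ ?y))"
        by (intro demazure_append_cong[OF _ _ _ refl]) auto
      then show ?thesis unfolding f cd' using True by (simp add: seg_path_def)
    qed
  qed
qed

lemma demazure_trim_greedy:
  assumes "greedy e l" "1 \<le> a" "a \<le> b" "e (a - 1) = 0" "e (Suc b) = 0" "e 0 = 0"
  shows "demazure (map \<sigma> (filter (\<lambda>p. p \<noteq> a \<and> p \<noteq> b) (concat (map seg_path l))))
    = demazure (map \<sigma> (concat (map seg_path (map (trim a b) l))))"
  using assms
proof (induction l arbitrary: e)
  case (Cons cd l)
  obtain c d where cd: "cd = (c, d)" by fastforce
  show ?case
  proof (cases "d < c")
    case True
    obtain c' d' where cd': "trim a b (c, d) = (c', d')" by fastforce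
    then have "d' < c'" using True Cons.prems by (auto simp: trim_def split: if_splits)
    then show ?thesis using Cons True by (simp add: cd cd' seg_path_def)
  next
    case False
    let ?f = "\<lambda>p. if p \<in> {c..d} then e p - 1 else e p"
    have g: "\<And>p. p \<in> {c..d} \<Longrightarrow> 0 < e p" "greedy ?f l"
      using Cons.prems(1) False by (auto simp: cd)
    have out: "a - 1 \<notin> {c..d}" "Suc b \<notin> {c..d}" "0 \<notin> {c..d}"
      using g(1) Cons.prems(4-6) by (metis less_nat_zero_code)+
    have IH: "demazure (map \<sigma> (filter (\<lambda>p. p \<noteq> a \<and> p \<noteq> b) (concat (map seg_path l))))
      = demazure (map \<sigma> (concat (map seg_path (map (trim a b) l))))"
      by (rule Cons.IH[OF g(2)]) (use Cons.prems out in auto)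
    have "demazure (map \<sigma> (filter (\<lambda>p. p \<noteq> a \<and> p \<noteq> b) (seg_path (c, d))))
      = demazure (map \<sigma> (seg_path (trim a b (c, d))))"
      by (rule demazure_trim) (use Cons.prems out False in auto)
    then show ?thesis
      using demazure_append_cong[OF set_map_\<sigma> set_map_\<sigma> set_map_\<sigma> _ IH] by (simp add: cd)
  qed
qed simp

text \<open>Not symmetric: in the nested case the second segment is strictly inside the first. In
  the other cases at least one position lies between them, so the supports are not even
  adjacent.\<close>

definition separated :: "nat \<times> nat \<Rightarrow> nat \<times> nat \<Rightarrow> bool" where
  "separated = (\<lambda>(a, b) (c, d). a < c \<and> d < b \<or> Suc b < c \<or> Suc d < a)"

text \<open>Induction on the length of the list, because the hypothesis is used for the trimmed tail
  and a modified function. The zeros of e at 0 and from n on keep the segments within {1..<n}.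
  Positivity of e on the resulting segments is carried along since it yields their separation from
  the first one.\<close>

lemma greedy_decomposition:
  assumes "greedy e l" "e 0 = 0" "\<And>p. n \<le> p \<Longrightarrow> e p = 0"
  shows "\<exists>gs. (\<forall>(c, d)\<in>set gs. 1 \<le> c \<and> c \<le> d \<and> d < n \<and> (\<forall>p\<in>{c..d}. 0 < e p)) \<and>
    sorted_wrt separated gs \<and>
    demazure (map \<sigma> (concat (map seg_path l))) = reflection_prod n (map (\<lambda>(c, d). seg c d) gs) \<and>
    len (demazure (map \<sigma> (concat (map seg_path l)))) = (\<Sum>(c, d)\<leftarrow>gs. 2 * (d - c) + 1)"
  using assms
proof (induction "length l" arbitrary: e l)
  case 0
  then show ?case using len_id by (intro exI[of _ "[]"]) (simp add: reflection_prod_def id_def)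
next
  case (Suc m)
  then obtain a b l' where l: "l = (a, b) # l'" "length l' = m" by (cases l) auto
  show ?case
  proof (cases "b < a")
    case True
    then have "greedy e l'" using Suc.prems l by simp
    from Suc.hyps(1)[OF l(2)[symmetric] this Suc.prems(2,3)] show ?thesis
      using True by (simp add: l seg_path_def)
  next
    case False
    let ?f = "\<lambda>p. if p \<in> {a..b} then e p - 1 else e p"
    let ?z = "\<lambda>p. if p = a \<or> p = b then 0 else ?f p"
    let ?r = "reflection n (seg a b)" and ?ps = "concat (map seg_path l')"
    let ?v = "demazure (map \<sigma> (concat (map seg_path (map (trim a b) l'))))"
    have g: "\<And>p. p \<in> {a..b} \<Longrightarrow> 0 < e p" "e (a - 1) = 0" "e (Suc b) = 0" "greedy ?f l'"
      using Suc.prems(1) False by (auto simp: l)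
    have ab: "1 \<le> a" "a \<le> b" "b < n"
      using g(1)[of a] g(1)[of b] Suc.prems(2) Suc.prems(3)[of b] False
      by (auto simp: Suc_le_eq not_less[symmetric] intro: gr0I)
    have f0: "?f (a - 1) = 0" "?f (Suc b) = 0" "?f 0 = 0" using g Suc.prems(2) ab by auto
    have pos: "1 \<le> p \<and> p < n \<and> Suc p \<noteq> a \<and> p \<noteq> Suc b" if "p \<in> set ?ps" for p
    proof -
      have "0 < ?f p" using greedy_path_positive[OF g(4) that] .
      then have "0 < e p" "p \<noteq> a - 1" "p \<noteq> Suc b" using f0 ab(1) by (auto split: if_splits)
      then show ?thesis using Suc.prems(2) Suc.prems(3)[of p] by (cases p; cases "n \<le> p") auto
    qed
    have v: "demazure (map \<sigma> (filter (\<lambda>p. p \<noteq> a \<and> p \<noteq> b) ?ps)) = ?v"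
      by (rule demazure_trim_greedy[OF g(4) ab(1,2) f0])
    have prod: "demazure (map \<sigma> (concat (map seg_path l))) = ?r \<circ> ?v"
      using reflection_seg_demazure(1)[of a b ?ps, OF ab pos] v demazure_seg_word(1)[OF ab]
      by (simp add: l demazure_append)
    have length: "len (?r \<circ> ?v) = len ?r + len ?v"
      using reflection_seg_demazure(2)[of a b ?ps, OF ab pos] v by simp
    have "greedy ?z (map (trim a b) l')"
      by (rule greedy_trim[OF g(4) ab(1,2) f0])
    moreover have "?z 0 = 0" "\<And>p. n \<le> p \<Longrightarrow> ?z p = 0" using Suc.prems by auto
    ultimately obtain gs where gs: "\<forall>(c, d)\<in>set gs. 1 \<le> c \<and> c \<le> d \<and> d < n \<and> (\<forall>p\<in>{c..d}. 0 < ?z p)"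
      "sorted_wrt separated gs" "?v = reflection_prod n (map (\<lambda>(c, d). seg c d) gs)"
      "len ?v = (\<Sum>(c, d)\<leftarrow>gs. 2 * (d - c) + 1)"
      using Suc.hyps(1)[of "map (trim a b) l'" ?z] l(2) by auto
    have sep: "separated (a, b) (c, d) \<and> (\<forall>p\<in>{c..d}. 0 < e p)" if "(c, d) \<in> set gs" for c d
    proof -
      have cd: "c \<le> d" "\<And>p. p \<in> {c..d} \<Longrightarrow> 0 < ?z p" using bspec[OF gs(1) that] by simp_all
      have pos_e: "0 < e p \<and> p \<noteq> a \<and> p \<noteq> b \<and> p \<noteq> a - 1 \<and> p \<noteq> Suc b" if "p \<in> {c..d}" for p
        using cd(2)[OF that] f0 by (auto split: if_splits)
      \<comment> \<open>Missing both a - 1 and a, the interval ends before a - 1 or starts after a;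
        likewise at b and b + 1. Only the alternatives of \<open>separated\<close> remain.\<close>
      have "a \<notin> {c..d}" "b \<notin> {c..d}" "a - 1 \<notin> {c..d}" "Suc b \<notin> {c..d}" using pos_e by blast+
      then have "separated (a, b) (c, d)" using cd(1) ab unfolding separated_def by auto
      then show ?thesis using pos_e by blast
    qed
    show ?thesis
      unfolding prod length
    proof (intro exI[of _ "(a, b) # gs"] conjI)
      show "\<forall>(c, d)\<in>set ((a, b) # gs). 1 \<le> c \<and> c \<le> d \<and> d < n \<and> (\<forall>p\<in>{c..d}. 0 < e p)"
        using gs(1) sep g(1) ab by fastforce
      show "sorted_wrt separated ((a, b) # gs)" using gs(2) sep by auto
      show "?r \<circ> ?v = reflection_prod n (map (\<lambda>(c, d). seg c d) ((a, b) # gs))"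
        using gs(3) by (simp add: reflection_prod_Cons)
      show "len ?r + len ?v = (\<Sum>(c, d)\<leftarrow>(a, b) # gs. 2 * (d - c) + 1)"
        using demazure_seg_word(2)[OF ab] gs(4) by simp
    qed
  qed
qed

subsection \<open>Positive real roots and the recursion for the degree\<close>

text \<open>An arc through the index 0 is the null root minus the finite positive root of the
  complementary interval; any other arc is itself an interval of indices in {1..<n}.\<close>

lemma pos_root_seg:
  assumes "1 \<le> a" "a \<le> b" "b < n"
  shows "seg a b \<in> pos_real_roots n"
proof -
  have interval: "(\<Sum>k\<in>{i..j}. simple_root k) \<in> finite_pos_roots n" if "1 \<le> i" "i \<le> j" "j < n" for i j
    using that unfolding finite_pos_roots_def by blast
  show ?thesis
  proof (cases "z + a \<le> n \<and> n \<le> z + b")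
    case True
    let ?\<beta> = "\<Sum>k\<in>{z + b + 1 - n..z + a - 1}. simple_root k"
    have "seg a b = - ?\<beta> + (\<lambda>k. 1 * null_root n k)"
    proof (rule eq_on_\<sigma>)
      fix p assume "p < n"
      then show "seg a b (\<sigma> p) = (- ?\<beta> + (\<lambda>k. 1 * null_root n k)) (\<sigma> p)"
        using True assms z_less
        by (simp add: seg_apply sum_simple_root_apply null_root_apply) (auto simp: \<sigma>_if)
    qed (use True assms z_less in \<open>auto simp: seg_out sum_simple_root_apply null_root_apply\<close>)
    moreover have "?\<beta> \<in> finite_pos_roots n"
      by (rule interval) (use True assms z_less in auto)
    ultimately show ?thesis unfolding pos_real_roots_def finite_roots_def
      by (intro CollectI exI[of _ "- ?\<beta>"] exI[of _ 1]) auto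
  next
    case False
    \<comment> \<open>The arc misses 0, so either no position or every position wraps past
      n.\<close>
    define i where "i = (if z + b < n then z + a else z + a - n)"
    define j where "j = (if z + b < n then z + b else z + b - n)"
    let ?\<beta> = "\<Sum>k\<in>{i..j}. simple_root k"
    have "seg a b = ?\<beta> + (\<lambda>k. 0 * null_root n k)"
    proof (rule eq_on_\<sigma>)
      fix p assume "p < n"
      then show "seg a b (\<sigma> p) = (?\<beta> + (\<lambda>k. 0 * null_root n k)) (\<sigma> p)"
        using False assms z_less
        by (simp add: seg_apply sum_simple_root_apply) (auto simp: \<sigma>_if i_def j_def)
    qed (use False assms z_less in \<open>auto simp: seg_out sum_simple_root_apply j_def\<close>)
    moreover have "?\<beta> \<in> finite_pos_roots n"
      by (rule interval) (use False assms z_less in \<open>auto simp: i_def j_def\<close>)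
    ultimately show ?thesis unfolding pos_real_roots_def finite_roots_def
      by (intro CollectI exI[of _ ?\<beta>] exI[of _ 0]) auto
  qed
qed

text \<open>The vanishing coefficient at z determines the multiple m of the null root: m = 0 and z
  outside the interval if the finite part is positive, m = 1 and z inside it if the finite part is
  negative.\<close>

lemma pos_root_is_seg:
  assumes "\<gamma> \<in> pos_real_roots n" "\<gamma> z = 0"
  obtains a b where "1 \<le> a" "a \<le> b" "b < n" "\<gamma> = seg a b"
proof -
  obtain \<alpha> m where \<gamma>: "\<gamma> = \<alpha> + (\<lambda>k. m * null_root n k)" and \<alpha>: "\<alpha> \<in> finite_roots n"
    and m: "m > 0 \<or> m = 0 \<and> \<alpha> \<in> finite_pos_roots n"
    using assms(1) by (auto simp: pos_real_roots_def)
  have "\<exists>a b. 1 \<le> a \<and> a \<le> b \<and> b < n \<and> \<gamma> = seg a b"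
  proof (cases "\<alpha> \<in> finite_pos_roots n")
    case True
    then obtain i j where ij: "1 \<le> i" "i \<le> j" "j < n"
      and \<alpha>k: "\<And>k. \<alpha> k = (if i \<le> k \<and> k \<le> j then 1 else 0)"
      by (rule finite_pos_root_cases) blast
    have "m = 0" "\<not> (i \<le> z \<and> z \<le> j)"
      using assms(2) m z_less by (auto simp: \<gamma> \<alpha>k null_root_apply split: if_splits)
    \<comment> \<open>The positions of i and j, counted cyclically from z.\<close>
    define a where "a = (if z < i then i - z else i + n - z)"
    define b where "b = (if z < i then j - z else j + n - z)"
    have ab: "1 \<le> a" "a \<le> b" "b < n"
      using ij \<open>\<not> (i \<le> z \<and> z \<le> j)\<close> z_less by (auto simp: a_def b_def)
    have "\<gamma> = seg a b"
    proof (rule eq_on_\<sigma>)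
      fix p assume "p < n"
      then show "\<gamma> (\<sigma> p) = seg a b (\<sigma> p)"
        using ij ab \<open>m = 0\<close> \<open>\<not> (i \<le> z \<and> z \<le> j)\<close> z_less
        by (simp add: seg_apply \<gamma> \<alpha>k) (auto simp: \<sigma>_if a_def b_def)
    qed (use ij \<open>m = 0\<close> in \<open>auto simp: \<gamma> \<alpha>k seg_out\<close>)
    then show ?thesis using ab by blast
  next
    case False
    then obtain \<beta> where \<beta>: "\<beta> \<in> finite_pos_roots n" "\<alpha> = - \<beta>"
      using \<alpha> by (auto simp: finite_roots_def)
    obtain i j where ij: "1 \<le> i" "i \<le> j" "j < n"
      and \<beta>k: "\<And>k. \<beta> k = (if i \<le> k \<and> k \<le> j then 1 else 0)"
      using \<beta>(1) by (rule finite_pos_root_cases) blast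
    have mz: "m = 1" "i \<le> z \<and> z \<le> j"
      using assms(2) m False z_less by (auto simp: \<gamma> \<beta>(2) \<beta>k null_root_apply split: if_splits)
    \<comment> \<open>The support is the complement of {i..j}: it runs from the index after j,
      around the cycle, to the index before i.\<close>
    define a where "a = j + 1 - z"
    define b where "b = i + n - z - 1"
    have ab: "1 \<le> a" "a \<le> b" "b < n"
      using ij mz z_less by (auto simp: a_def b_def)
    have "\<gamma> = seg a b"
    proof (rule eq_on_\<sigma>)
      fix p assume "p < n"
      then show "\<gamma> (\<sigma> p) = seg a b (\<sigma> p)"
        using ij ab mz z_less
        by (simp add: seg_apply \<gamma> \<beta>(2) \<beta>k null_root_apply) (auto simp: \<sigma>_if a_def b_def)
    qed (use ij mz in \<open>auto simp: \<gamma> \<beta>(2) \<beta>k seg_out null_root_apply\<close>)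
    then show ?thesis using ab by blast
  qed
  then show ?thesis using that by blast
qed

lemma seg_le:
  assumes "is_degree n d" "1 \<le> a" "b < n"
  shows "seg a b \<le> d \<longleftrightarrow> (\<forall>p\<in>{a..b}. 0 < d (\<sigma> p))"
proof
  assume le: "seg a b \<le> d"
  show "\<forall>p\<in>{a..b}. 0 < d (\<sigma> p)"
  proof
    fix p assume "p \<in> {a..b}"
    then have "seg a b (\<sigma> p) = 1" by (auto simp: seg_def)
    then show "0 < d (\<sigma> p)" using le_funD[OF le, of "\<sigma> p"] by linarith
  qed
next
  assume pos: "\<forall>p\<in>{a..b}. 0 < d (\<sigma> p)"
  have "0 \<le> d k" for k using assms(1) by (auto simp: is_degree_def le_fun_def)
  then show "seg a b \<le> d" using pos unfolding le_fun_def seg_def by auto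
qed

text \<open>If d were positive next to an end of the segment, the segment could be enlarged there,
  against maximality. The enlarged segment stays within {1..<n}, because positions 0 and n are both
  z, where d vanishes.\<close>

lemma maximal_root_seg:
  assumes d: "is_degree n d" "d z = 0" and max: "maximal_root n d \<alpha>"
  obtains a b where "1 \<le> a" "a \<le> b" "b < n" "\<alpha> = seg a b" "\<forall>p\<in>{a..b}. 0 < d (\<sigma> p)"
    "d (\<sigma> (a - 1)) = 0" "d (\<sigma> (Suc b)) = 0"
proof -
  have d0: "0 \<le> d k" for k using d(1) by (auto simp: is_degree_def le_fun_def)
  have \<alpha>: "\<alpha> \<in> pos_real_roots n" "\<alpha> \<le> d"
    and maxD: "\<And>\<beta>. \<beta> \<in> pos_real_roots n \<Longrightarrow> \<beta> \<le> d \<Longrightarrow> \<alpha> \<le> \<beta> \<Longrightarrow> \<beta> = \<alpha>"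
    using max by (auto simp: maximal_root_def)
  have "\<alpha> z = 0"
    using le_funD[OF \<alpha>(2), of z] le_funD[OF pos_real_root_props(2)[OF \<alpha>(1)], of z] d(2) by simp
  then obtain a b where ab: "1 \<le> a" "a \<le> b" "b < n" "\<alpha> = seg a b"
    using pos_root_is_seg[OF \<alpha>(1)] by blast
  have pos: "\<forall>p\<in>{a..b}. 0 < d (\<sigma> p)" using \<alpha>(2) seg_le[OF d(1) ab(1,3)] ab(4) by simp
  have no_bigger: False
    if "1 \<le> a'" "a' \<le> a" "b \<le> b'" "b' < n" "q \<in> {a'..b'}" "q \<notin> {a..b}"
      "\<forall>p\<in>{a'..b'}. 0 < d (\<sigma> p)" for a' b' q
  proof -
    have "seg a b \<le> seg a' b'" using that(2,3) by (auto simp: seg_def le_fun_def)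
    then have "seg a' b' = seg a b"
      using maxD[of "seg a' b'"] pos_root_seg[of a' b'] seg_le[OF d(1), of a' b'] that ab by auto
    then have "seg a' b' (\<sigma> q) = seg a b (\<sigma> q)" by simp
    then show False using that ab by (simp add: seg_apply split: if_splits)
  qed
  have "d (\<sigma> (a - 1)) = 0"
  proof (rule ccontr)
    assume n0: "d (\<sigma> (a - 1)) \<noteq> 0"
    then have "a \<noteq> 1" using d(2) \<sigma>_0 by auto
    moreover have "0 < d (\<sigma> p)" if "p \<in> {a - 1..b}" for p
      using n0 d0[of "\<sigma> (a - 1)"] pos that by (cases "p = a - 1") auto
    moreover have "1 \<le> a - 1" "a - 1 \<notin> {a..b}" if "a \<noteq> 1" using ab that by auto
    ultimately show False using no_bigger[of "a - 1" b "a - 1"] ab by auto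
  qed
  moreover have "d (\<sigma> (Suc b)) = 0"
  proof (rule ccontr)
    assume n0: "d (\<sigma> (Suc b)) \<noteq> 0"
    then have "Suc b \<noteq> n" using d(2) \<sigma>_0 \<sigma>_n by metis
    moreover have "0 < d (\<sigma> p)" if "p \<in> {a..Suc b}" for p
      using n0 d0[of "\<sigma> (Suc b)"] pos that by (cases "p = Suc b") auto
    ultimately show False using no_bigger[of a "Suc b" "Suc b"] ab by auto
  qed
  ultimately show ?thesis using that ab pos by blast
qed

text \<open>Unwinds the recursion along the height: the chosen maximal root is a segment and becomes
  the head of the list. The coefficients are read as 0 from n on, since \<sigma> is periodic and
  would repeat them.\<close>

lemma z_elem_greedy:
  assumes "is_degree n d" "d z = 0"
  shows "\<exists>l. greedy (\<lambda>p. if p < n then nat (d (\<sigma> p)) else 0) l \<and>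
    z_elem n d = demazure (map \<sigma> (concat (map seg_path l)))"
  using assms
proof (induction "height n d" arbitrary: d rule: less_induct)
  case less
  let ?e = "\<lambda>d p. if p < n then nat (d (\<sigma> p)) else 0"
  show ?case
  proof (cases "d = 0")
    case True
    then have "z_elem n d = id" by (simp add: z_elem.simps)
    then show ?thesis by (intro exI[of _ "[]"]) simp
  next
    case False
    define \<alpha> where "\<alpha> = (SOME \<alpha>. maximal_root n d \<alpha>)"
    have max: "maximal_root n d \<alpha>"
      unfolding \<alpha>_def 
      by (rule someI_ex[of "maximal_root n d"], rule maximal_root_exists) (use less.prems(1) False n3 in auto)
    obtain a b where ab: "1 \<le> a" "a \<le> b" "b < n" "\<alpha> = seg a b" "\<forall>p\<in>{a..b}. 0 < d (\<sigma> p)"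
      "d (\<sigma> (a - 1)) = 0" "d (\<sigma> (Suc b)) = 0"
      using maximal_root_seg[OF less.prems max] .
    have deg: "is_degree n (d - \<alpha>)"
      using max less.prems(1) pos_real_root_props(1)[of \<alpha> n]
      by (auto simp: maximal_root_def is_degree_def root_lattice_def le_fun_def)
    have "(d - \<alpha>) z = 0"
      using seg_apply[of a b 0] ab less.prems(2) \<sigma>_0 by simp
    from less.hyps[OF height_diff_maximal_root[OF less.prems(1) max] deg this]
    obtain l where l: "greedy (?e (d - \<alpha>)) l"
      "z_elem n (d - \<alpha>) = demazure (map \<sigma> (concat (map seg_path l)))" by blast
    have "?e (d - \<alpha>) = (\<lambda>p. if p \<in> {a..b} then ?e d p - 1 else ?e d p)"
      using ab by (auto simp: fun_eq_iff seg_apply)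
    then have "greedy (?e d) ((a, b) # l)" using l(1) ab by auto
    moreover have "z_elem n d = hecke_prod n (reflection n \<alpha>) (z_elem n (d - \<alpha>))"
      using less.prems(1) False n3 \<alpha>_def by (subst z_elem.simps) (simp add: Let_def)
    then have "z_elem n d = demazure (map \<sigma> (concat (map seg_path ((a, b) # l))))"
      using l(2) demazure_seg_word(1)[OF ab(1-3)] ab(4)
        hecke_prod_demazure[OF set_map_\<sigma> set_map_\<sigma>, of "seg_path (a, b)" "concat (map seg_path l)"] by simp
    ultimately show ?thesis by blast
  qed
qed

section \<open>Supports and orthogonality of segments\<close>

lemma supp_seg: "supp n (seg a b) = \<sigma> ` {a..b}"
  by (auto simp: supp_def seg_def)

lemma card_supp_seg:
  assumes "b < n"
  shows "card (supp n (seg a b)) = Suc b - a"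
proof -
  have "inj_on \<sigma> {a..b}" using assms by (auto simp: inj_on_def \<sigma>_eq_iff)
  then show ?thesis by (simp add: supp_seg card_image)
qed

text \<open>Each simple root strictly between the ends of a segment is orthogonal to it, and the
  inner segment is a sum of such simple roots.\<close>

lemma form_nested_seg:
  assumes "1 \<le> a" "b < n" "a < c" "d < b"
  shows "form (seg c d) (seg a b) = 0"
  unfolding form_eq
proof (rule sum.neutral, rule ballI)
  fix i assume "i \<in> {..<n}"
  show "seg c d i * (2 * seg a b i - seg a b (Suc i mod n) - seg a b ((i + n - 1) mod n)) = 0"
  proof (cases "i \<in> \<sigma> ` {c..d}")
    case True
    then obtain p where p: "i = \<sigma> p" "c \<le> p" "p \<le> d" by auto
    then have "form (simple_root i) (seg a b) = 0" using form_simple_seg[of p a b] assms by auto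
    then show ?thesis using form_simple_root[of i "seg a b"] p(1) by simp
  qed (simp add: seg_def)
qed

lemma separated_roots:
  assumes "separated (a, b) (c, d)" "1 \<le> a" "b < n" "1 \<le> c" "d < n"
  shows "disconnected n (supp n (seg a b)) (supp n (seg c d)) \<or>
    form (seg a b) (seg c d) = 0 \<and> seg c d \<le> seg a b"
proof (cases "a < c \<and> d < b")
  case True
  then have "seg c d \<le> seg a b" by (auto simp: seg_def le_fun_def)
  then show ?thesis using True form_nested_seg[of a b c d] form_sym assms by auto
next
  case False
  then have far: "Suc b < c \<or> Suc d < a" using assms(1) by (auto simp: separated_def)
  have "\<sigma> p \<noteq> \<sigma> q \<and> \<not> adjacent n (\<sigma> p) (\<sigma> q)" if "p \<in> {a..b}" "q \<in> {c..d}" for p q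
    using that far assms \<sigma>_eq_iff[of p q] adjacent_\<sigma>[of p q] by auto
  then show ?thesis unfolding supp_seg disconnected_def by blast
qed

end

lemma disconnected_sym: "disconnected n A B = disconnected n B A"
  by (auto simp: disconnected_def adjacent_def)

theorem theorem3p2:
  fixes n :: nat and d :: "nat \<Rightarrow> int"
  assumes "n \<ge> 3"
    and "is_degree n d"
    and "\<exists>i<n. d i = 0"
  shows "\<exists>\<gamma>s. set \<gamma>s \<subseteq> pos_real_roots n \<and>
           z_elem n d = reflection_prod n \<gamma>s \<and>
           (\<forall>i<length \<gamma>s. \<forall>j<length \<gamma>s. i \<noteq> j \<longrightarrow>
              disconnected n (supp n (\<gamma>s ! i)) (supp n (\<gamma>s ! j)) \<or>
              root_form n (\<gamma>s ! i) (\<gamma>s ! j) = 0 \<and> (\<gamma>s ! i \<le> \<gamma>s ! j \<or> \<gamma>s ! j \<le> \<gamma>s ! i)) \<and>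
           weyl_length n (z_elem n d) = (\<Sum>\<gamma>\<leftarrow>\<gamma>s. weyl_length n (reflection n \<gamma>)) \<and>
           int (weyl_length n (z_elem n d)) = (\<Sum>\<gamma>\<leftarrow>\<gamma>s. 2 * int (card (supp n \<gamma>)) - 1)"
proof -
  obtain z where z: "z < n" "d z = 0" using assms(3) by blast
  interpret cut_affine_type_A n z by unfold_locales (use assms(1) z in auto)
  let ?e = "\<lambda>p. if p < n then nat (d (\<sigma> p)) else 0"
  obtain l where l: "greedy ?e l" "z_elem n d = demazure (map \<sigma> (concat (map seg_path l)))"
    using z_elem_greedy[OF assms(2) z(2)] by blast
  have "?e 0 = 0" "\<And>p. n \<le> p \<Longrightarrow> ?e p = 0" using \<sigma>_0 z by auto
  from greedy_decomposition[OF l(1) this]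
  obtain gs where gs: "\<And>c d. (c, d) \<in> set gs \<Longrightarrow> 1 \<le> c \<and> c \<le> d \<and> d < n"
    and sep: "sorted_wrt separated gs"
    and prod: "z_elem n d = reflection_prod n (map (\<lambda>(c, d). seg c d) gs)"
    and length: "weyl_length n (z_elem n d) = (\<Sum>(c, d)\<leftarrow>gs. 2 * (d - c) + 1)"
    unfolding l(2)[symmetric] by fast
  let ?\<gamma>s = "map (\<lambda>(c, d). seg c d) gs"
  let ?Q = "\<lambda>\<alpha> \<beta>. disconnected n (supp n \<alpha>) (supp n \<beta>) \<or> root_form n \<alpha> \<beta> = 0 \<and> (\<alpha> \<le> \<beta> \<or> \<beta> \<le> \<alpha>)"
  \<comment> \<open>\<open>separated\<close> is only available for an earlier and a later segment of
    the list; symmetry gives the other order.\<close>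
  have Q_sym: "?Q \<alpha> \<beta> = ?Q \<beta> \<alpha>" for \<alpha> \<beta>
    using disconnected_sym form_sym by metis
  have Q: "?Q (?\<gamma>s ! i) (?\<gamma>s ! j)" if "i < j" "j < length gs" for i j
  proof -
    obtain a b c d where eq: "gs ! i = (a, b)" "gs ! j = (c, d)" by fastforce
    then have "(a, b) \<in> set gs" "(c, d) \<in> set gs" using that by (metis nth_mem order_less_trans)+
    moreover have "separated (a, b) (c, d)"
      using sorted_wrt_nth_less[OF sep that] eq by simp
    ultimately have "?Q (seg a b) (seg c d)" using separated_roots[of a b c d] gs by blast
    then show ?thesis using that eq by simp
  qed
  have "set ?\<gamma>s \<subseteq> pos_real_roots n" using gs pos_root_seg by auto
  moreover have "\<forall>i<length ?\<gamma>s. \<forall>j<length ?\<gamma>s. i \<noteq> j \<longrightarrow> ?Q (?\<gamma>s ! i) (?\<gamma>s ! j)"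
    using Q Q_sym by (metis length_map linorder_neqE_nat)
  moreover have "weyl_length n (z_elem n d) = (\<Sum>\<gamma>\<leftarrow>?\<gamma>s. weyl_length n (reflection n \<gamma>))"
    unfolding length map_map
    by (rule arg_cong[where f = sum_list], rule map_cong[OF refl])
      (use gs demazure_seg_word(2) in auto)
  moreover have "int (weyl_length n (z_elem n d)) = (\<Sum>\<gamma>\<leftarrow>?\<gamma>s. 2 * int (card (supp n \<gamma>)) - 1)"
  proof -
    have "int (weyl_length n (z_elem n d)) = (\<Sum>(c, d)\<leftarrow>gs. int (2 * (d - c) + 1))"
      unfolding length by (induction gs) auto
    also have "\<dots> = (\<Sum>\<gamma>\<leftarrow>?\<gamma>s. 2 * int (card (supp n \<gamma>)) - 1)"
      unfolding map_map
    proof (rule arg_cong[where f = sum_list], rule map_cong[OF refl])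
      fix x assume "x \<in> set gs"
      then obtain c d where "x = (c, d)" "c \<le> d" "d < n" using gs by (metis surj_pair)
      then show "(\<lambda>(c, d). int (2 * (d - c) + 1)) x
          = ((\<lambda>\<gamma>. 2 * int (card (supp n \<gamma>)) - 1) \<circ> (\<lambda>(c, d). seg c d)) x"
        by (simp add: card_supp_seg Suc_diff_le)
    qed
    finally show ?thesis .
  qed
  ultimately show ?thesis using prod by blast
qed

end
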